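(* Let $A$ be a discriminant form of even signature and level $N$, let $k\in\mathbb{Z}$, and let $p$ be a prime which is a square modulo $N$, with $r\in U(N)$ such that $p\equiv r^2\pmod N$. Let $f\in M_{k,A}$ have Fourier expansion $f(\tau)=\sum_{\lambda\in A}\sum_{n\in\mathbb{Z}+\lambda^2/2}c(\lambda,n)e(n\tau)\otimes\mathfrak e_\lambda$. Then \[ f\mid_{k,A}T\!\left(\begin{pmatrix}p&0\\0&1\end{pmatrix},r\right)=\sum_{\lambda\in A}\sum_{n\in\mathbb{Z}+\lambda^2/2}b(\lambda,n)e(n\tau)\otimes\mathfrak e_\lambda, \qquad b(\lambda,n)=c(r\lambda,pn)+p^{k-1}c(\lambda/r,n/p), \] where $c(\lambda/r,n/p)$ is understood to be $0$ if $\operatorname{ord}_p(n)=0$.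
   Context: A discriminant form is a finite abelian group $A$ with a non-degenerate quadratic form $\lambda\mapsto\lambda^2/2\in\mathbb{Q}/\mathbb{Z}$, bilinear form $(\lambda,\mu)=(\lambda+\mu)^2/2-\lambda^2/2-\mu^2/2$. The level $N$ is the smallest positive integer with $N\lambda^2/2=0$ for all $\lambda$; $A$ is a $\mathbb{Z}/N\mathbb{Z}$-module and $U(N)=(\mathbb{Z}/N\mathbb{Z})^\times$ acts on it ($\lambda/r:=r^{-1}\lambda$). $e(z)=e^{2\pi iz}$; $\operatorname{sig}(A)\in\mathbb{Z}/8\mathbb{Z}$ is given by $\sum_\lambda e(\lambda^2/2)=\sqrt{|A|}e(\operatorname{sig}(A)/8)$; $g_d(A)=\sum_\lambda e(d\lambda^2/2)$, $g(A)=g_1(A)$. For even signature the Weil representation $\rho_A$ of $\Gamma=\operatorname{SL}_2(\mathbb{Z})$ on $\mathbb{C}[A]$ (basis $\mathfrak e_\lambda$) is $\rho_A\begin{pmatrix}1&1\\0&1\end{pmatrix}\mathfrak e_\lambda=e(\lambda^2/2)\mathfrak e_\lambda$, $\rho_A\begin{pmatrix}0&-1\\1&0\end{pmatrix}\mathfrak e_\lambda=\frac{e(-\operatorname{sig}(A)/8)}{\sqrt{|A|}}\sum_\mu e(-(\lambda,\mu))\mathfrak e_\mu$; it factors through $\operatorname{SL}_2(\mathbb{Z}/N\mathbb{Z})$. For $(M,r)\in\operatorname{GL}_2(\mathbb{Z}/N\mathbb{Z})\times U(N)$ with $\det M\equiv r^2$, put $\rho_A(M,r)=\frac{g(A)}{g_r(A)}\rho_A(r^{-1}M)$.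 $M_{k,A}$ is the space of holomorphic $f:\mathbb{H}\to\mathbb{C}[A]$ with $f(\gamma\tau)=(c\tau+d)^k\rho_A(\gamma)f(\tau)$ for all $\gamma=\begin{pmatrix}a&b\\c&d\end{pmatrix}\in\Gamma$ and holomorphic at $\infty$; such $f$ has an expansion as in the claim. For $\gamma\in\operatorname{GL}_2^+(\mathbb{Q})$ and $h:\mathbb{H}\to\mathbb{C}$ let $(h\mid_k\gamma)(\tau)=\det(\gamma)^{k/2}(c\tau+d)^{-k}h(\gamma\tau)$. For an integral matrix $\gamma$ with $\det\gamma>0$ coprime to $N$ and $r\in U(N)$ with $\det\gamma\equiv r^2\pmod N$, and $f=\sum_\lambda f_\lambda\otimes\mathfrak e_\lambda$, set $f\mid_{k,A}(\gamma,r)=\sum_\lambda (f_\lambda\mid_k\gamma)\otimes \rho_A(\bar\gamma,r)^{-1}\mathfrak e_\lambda$, $\bar\gamma$ the reduction mod $N$. Hecke operator: for such $(M,r)$, if $\Gamma M\Gamma=\bigsqcup_i\Gamma\gamma_i$, then $f\mid_{k,A}T(M,r)=\det(M)^{k/2-1}\sum_i f\mid_{k,A}(\gamma_i,r)$. *)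

theory Defs
  imports "HOL-Analysis.Analysis" "HOL-Number_Theory.Number_Theory"
begin

text \<open>
  The finite abelian group \<open>A\<close> is a type of class \<open>{ab_group_add, finite}\<close>. A form with values in
  \<open>\<rat>/\<int>\<close> is given by a function \<open>q\<close> choosing a rational representative \<open>q x\<close> of each value \<open>x\<^sup>2/2\<close>;
  equations in \<open>\<rat>/\<int>\<close> become membership of a difference in \<open>\<int>\<close>, and everything below depends on
  \<open>q\<close> modulo \<open>\<int>\<close> only. Elements of \<open>\<int>/N\<int>\<close> and matrices over \<open>\<int>/N\<int>\<close> are likewise given by integral
  representatives.
\<close>

definition zsmul :: "int \<Rightarrow> 'a::ab_group_add \<Rightarrow> 'a" where
  "zsmul m x = (if 0 \<le> m then (\<Sum>i<nat m. x) else - (\<Sum>i<nat (- m). x))"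

definition bil :: "('a::ab_group_add \<Rightarrow> rat) \<Rightarrow> 'a \<Rightarrow> 'a \<Rightarrow> rat" where
  "bil q x y = q (x + y) - q x - q y"

definition discriminant_form :: "('a::{ab_group_add,finite} \<Rightarrow> rat) \<Rightarrow> bool" where
  "discriminant_form q \<longleftrightarrow>
     (\<forall>m x. q (zsmul m x) - of_int (m\<^sup>2) * q x \<in> \<int>) \<and>
     (\<forall>x y z. bil q (x + y) z - (bil q x z + bil q y z) \<in> \<int>) \<and>
     (\<forall>x. (\<forall>y. bil q x y \<in> \<int>) \<longrightarrow> x = 0)"

definition level :: "('a \<Rightarrow> rat) \<Rightarrow> nat" where
  "level q = (LEAST N. N > 0 \<and> (\<forall>x. of_nat N * q x \<in> \<int>))"

definition e2pi :: "complex \<Rightarrow> complex" where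
  "e2pi z = exp (2 * of_real pi * \<i> * z)"

definition gauss_sum :: "('a::finite \<Rightarrow> rat) \<Rightarrow> int \<Rightarrow> complex" where
  "gauss_sum q d = (\<Sum>x\<in>UNIV. e2pi (of_int d * of_rat (q x)))"

text \<open>The integer \<open>s\<close> represents the signature in \<open>\<int>/8\<int>\<close>.\<close>

definition has_signature :: "('a::finite \<Rightarrow> rat) \<Rightarrow> int \<Rightarrow> bool" where
  "has_signature q s \<longleftrightarrow>
     gauss_sum q 1 = of_real (sqrt (real CARD('a))) * e2pi (of_int s / 8)"

definition mat2 :: "int \<Rightarrow> int \<Rightarrow> int \<Rightarrow> int \<Rightarrow> int^2^2" where
  "mat2 a b c d = vector [vector [a, b], vector [c, d]]"

definition SL2Z :: "(int^2^2) set" where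
  "SL2Z = {M. det M = 1}"

definition mat_cong :: "nat \<Rightarrow> int^2^2 \<Rightarrow> int^2^2 \<Rightarrow> bool" where
  "mat_cong N M M' \<longleftrightarrow> (\<forall>i j. [M $ i $ j = M' $ i $ j] (mod int N))"

text \<open>Integral representatives of the elements of \<open>SL\<^sub>2(\<int>/N\<int>)\<close>; this set contains \<open>SL\<^sub>2(\<int>)\<close>.\<close>

definition SL2_mod :: "nat \<Rightarrow> (int^2^2) set" where
  "SL2_mod N = {M. [det M = 1] (mod int N)}"

text \<open>
  \<open>'a cgroup_alg\<close> is \<open>complex^'a\<close> and \<open>'a cgroup_mat\<close> is \<open>complex^'a^'a\<close>, spelled with \<open>vec\<close> to leave the
  sort of \<open>'a\<close> free. The basis vectors of \<open>\<complex>[A]\<close> are \<open>axis x 1\<close>.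
\<close>

type_synonym 'a cgroup_alg = "(complex, 'a) vec"
type_synonym 'a cgroup_mat = "((complex, 'a) vec, 'a) vec"

text \<open>
  The predicate says that \<open>R\<close> is
  the Weil representation of \<open>SL\<^sub>2(\<int>)\<close> attached to a form of signature \<open>s\<close>, regarded as a representation
  of \<open>SL\<^sub>2(\<int>/N\<int>)\<close>, through which it factors. Since the two matrices in the last two clauses generate
  \<open>SL\<^sub>2(\<int>)\<close>, which surjects onto \<open>SL\<^sub>2(\<int>/N\<int>)\<close>, the values of \<open>R\<close> on \<open>SL2_mod (level q)\<close> are uniquely
  determined.
\<close>

definition weil_representation ::
    "('a::{ab_group_add,finite} \<Rightarrow> rat) \<Rightarrow> int \<Rightarrow> (int^2^2 \<Rightarrow> 'a cgroup_mat) \<Rightarrow> bool" where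
  "weil_representation q s R \<longleftrightarrow>
     (\<forall>M\<in>SL2_mod (level q). \<forall>M'\<in>SL2_mod (level q). mat_cong (level q) M M' \<longrightarrow> R M = R M') \<and>
     R (mat 1) = mat 1 \<and>
     (\<forall>M\<in>SL2_mod (level q). \<forall>M'\<in>SL2_mod (level q). R (M ** M') = R M ** R M') \<and>
     (\<forall>x. R (mat2 1 1 0 1) *v axis x 1 = e2pi (of_rat (q x)) *s axis x 1) \<and>
     (\<forall>x. R (mat2 0 (-1) 1 0) *v axis x 1 =
        (e2pi (- of_int s / 8) / of_real (sqrt (real CARD('a)))) *s
          (\<Sum>y\<in>UNIV. e2pi (- of_rat (bil q x y)) *s axis y 1))"

text \<open>The extension to pairs \<open>(M, r)\<close> with \<open>r\<close> a unit and \<open>det M = r\<^sup>2\<close> modulo \<open>N\<close>.\<close>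

definition weil_ext ::
    "('a::{ab_group_add,finite} \<Rightarrow> rat) \<Rightarrow> (int^2^2 \<Rightarrow> 'a cgroup_mat) \<Rightarrow> int^2^2 \<Rightarrow> int \<Rightarrow> 'a cgroup_mat"
  where
  "weil_ext q R M r =
     mat (gauss_sum q 1 / gauss_sum q r) **
       R (\<chi> i j. modular_inverse (int (level q)) r * M $ i $ j)"

definition upper_half_plane :: "complex set" where
  "upper_half_plane = {\<tau>. Im \<tau> > 0}"

definition aut_factor :: "int^2^2 \<Rightarrow> complex \<Rightarrow> complex" where
  "aut_factor M \<tau> = of_int (M $ 2 $ 1) * \<tau> + of_int (M $ 2 $ 2)"

definition moebius :: "int^2^2 \<Rightarrow> complex \<Rightarrow> complex" where
  "moebius M \<tau> = (of_int (M $ 1 $ 1) * \<tau> + of_int (M $ 1 $ 2)) / aut_factor M \<tau>"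

definition exponents :: "('a \<Rightarrow> rat) \<Rightarrow> 'a \<Rightarrow> rat set" where
  "exponents q x = {n. n - q x \<in> \<int>}"

definition has_fourier_expansion ::
    "('a::finite \<Rightarrow> rat) \<Rightarrow> (complex \<Rightarrow> 'a cgroup_alg) \<Rightarrow> ('a \<Rightarrow> rat \<Rightarrow> complex) \<Rightarrow> bool" where
  "has_fourier_expansion q f c \<longleftrightarrow>
     (\<forall>\<tau>\<in>upper_half_plane. \<forall>x.
        ((\<lambda>n. c x n * e2pi (of_rat n * \<tau>)) has_sum (f \<tau> $ x)) (exponents q x))"

definition modular_forms ::
    "int \<Rightarrow> ('a::{ab_group_add,finite} \<Rightarrow> rat) \<Rightarrow> (int^2^2 \<Rightarrow> 'a cgroup_mat) \<Rightarrow>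
      (complex \<Rightarrow> 'a cgroup_alg) set" where
  "modular_forms k q R = {f.
     (\<forall>x. (\<lambda>\<tau>. f \<tau> $ x) holomorphic_on upper_half_plane) \<and>
     (\<forall>M\<in>SL2Z. \<forall>\<tau>\<in>upper_half_plane.
        f (moebius M \<tau>) = (aut_factor M \<tau> powi k) *s (R M *v f \<tau>)) \<and>
     (\<exists>c. has_fourier_expansion q f c \<and> (\<forall>x n. n < 0 \<longrightarrow> c x n = 0))}"

definition slash :: "int \<Rightarrow> int^2^2 \<Rightarrow> (complex \<Rightarrow> complex) \<Rightarrow> complex \<Rightarrow> complex" where
  "slash k M h \<tau> =
     of_real (real_of_int (det M) powr (of_int k / 2)) * aut_factor M \<tau> powi (- k) *
       h (moebius M \<tau>)"

definition vslash ::
    "int \<Rightarrow> ('a::{ab_group_add,finite} \<Rightarrow> rat) \<Rightarrow> (int^2^2 \<Rightarrow> 'a cgroup_mat) \<Rightarrow>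
      int^2^2 \<Rightarrow> int \<Rightarrow> (complex \<Rightarrow> 'a cgroup_alg) \<Rightarrow> complex \<Rightarrow> 'a cgroup_alg" where
  "vslash k q R M r f \<tau> =
     (\<Sum>x\<in>UNIV. slash k M (\<lambda>\<tau>. f \<tau> $ x) \<tau> *s (matrix_inv (weil_ext q R M r) *v axis x 1))"

definition left_coset :: "int^2^2 \<Rightarrow> (int^2^2) set" where
  "left_coset M = {G ** M | G. G \<in> SL2Z}"

definition double_coset :: "int^2^2 \<Rightarrow> (int^2^2) set" where
  "double_coset M = {G ** M ** H | G H. G \<in> SL2Z \<and> H \<in> SL2Z}"

text \<open>
  The sum runs over the cosets \<open>\<Gamma>\<gamma>\<close> contained in \<open>\<Gamma>M\<Gamma>\<close>, with an arbitrarily chosen representative of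
  each; for modular forms the summands do not depend on this choice.
\<close>

definition hecke ::
    "int \<Rightarrow> ('a::{ab_group_add,finite} \<Rightarrow> rat) \<Rightarrow> (int^2^2 \<Rightarrow> 'a cgroup_mat) \<Rightarrow>
      int^2^2 \<Rightarrow> int \<Rightarrow> (complex \<Rightarrow> 'a cgroup_alg) \<Rightarrow> complex \<Rightarrow> 'a cgroup_alg" where
  "hecke k q R M r f \<tau> =
     of_real (real_of_int (det M) powr (of_int k / 2 - 1)) *s
       (\<Sum>C\<in>left_coset ` double_coset M. vslash k q R (SOME G. G \<in> C) r f \<tau>)"

text \<open>The value at \<open>0\<close> is \<open>\<infinity>\<close>, whereas the library's \<open>multiplicity p 0\<close> is \<open>0\<close>.\<close>

definition rat_ord :: "nat \<Rightarrow> rat \<Rightarrow> ereal" where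
  "rat_ord p n =
     (if n = 0 then \<infinity>
      else ereal (real (multiplicity (int p) (fst (quotient_of n))) -
                  real (multiplicity (int p) (snd (quotient_of n)))))"

end

theory Submission
  imports Defs
begin

text \<open>
  The double coset of \<open>diag(p, 1)\<close> consists of the left cosets of \<open>diag(p, 1)\<close> and of \<open>(1 b; 0 p)\<close> for
  \<open>0 \<le> b < p\<close>. Multiplied by \<open>r\<^sup>-\<^sup>1\<close> modulo \<open>N\<close>, these become \<open>diag(r, 1/r)\<close> and \<open>diag(1/r, r) T\<^sup>b\<close>. From
  \<open>S diag(d, a) = T\<^sup>a S T\<^sup>d S T\<^sup>a\<close> for \<open>d a = 1\<close>, completing the square shows that \<open>diag(d, a)\<close> maps \<open>e\<^sub>x\<close>
  to \<open>g\<^sub>d/g e\<^bsub>a x\<^esub>\<close>; in particular \<open>g\<^sub>d \<noteq> 0\<close>, and the factor \<open>g/g\<^sub>r\<close> of the extended representation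
  cancels. Hence \<open>diag(p, 1)\<close> contributes the dilation \<open>f\<^bsub>x/r\<^esub>(p\<tau>)\<close>, while averaging
  \<open>f\<^bsub>r x\<^esub>((\<tau> + b)/p)\<close> against \<open>e(-b q(x))\<close> selects the exponents divisible by \<open>p\<close>.
\<close>

subsection \<open>Integral two-by-two matrices\<close>

lemma mat2_nth [simp]:
  "mat2 a b c d $ 1 $ 1 = a" "mat2 a b c d $ 1 $ 2 = b"
  "mat2 a b c d $ 2 $ 1 = c" "mat2 a b c d $ 2 $ 2 = d"
  by (simp_all add: mat2_def)

lemma mat2_eq_iff:
  "M = M' \<longleftrightarrow> M $ 1 $ 1 = M' $ 1 $ 1 \<and> M $ 1 $ 2 = M' $ 1 $ 2 \<and>
     M $ 2 $ 1 = M' $ 2 $ 1 \<and> M $ 2 $ 2 = M' $ 2 $ 2" for M M' :: "int^2^2"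
  by (auto simp: vec_eq_iff forall_2)

lemma mat2_cases: obtains a b c d where "M = mat2 a b c d"
  by (metis mat2_eq_iff mat2_nth)

lemma mat2_mult [simp]:
  "mat2 a b c d ** mat2 a' b' c' d' =
     mat2 (a * a' + b * c') (a * b' + b * d') (c * a' + d * c') (c * b' + d * d')"
  by (simp add: mat2_eq_iff matrix_matrix_mult_def sum_2)

lemma det_mat2 [simp]: "det (mat2 a b c d) = a * d - b * c"
  by (simp add: det_2)

lemma mat2_one: "mat 1 = mat2 1 0 0 1"
  by (simp add: mat2_eq_iff mat_def)

lemma mat_cong_mat2 [simp]:
  "mat_cong N (mat2 a b c d) (mat2 a' b' c' d') \<longleftrightarrow>
     [a = a'] (mod int N) \<and> [b = b'] (mod int N) \<and> [c = c'] (mod int N) \<and> [d = d'] (mod int N)"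
  by (auto simp: mat_cong_def forall_2)

lemma smult_mat2 [simp]:
  "(\<chi> i j. u * mat2 a b c d $ i $ j) = mat2 (u * a) (u * b) (u * c) (u * d)"
  by (simp add: mat2_eq_iff)

lemma mat2_in_SL2Z [simp]: "mat2 a b c d \<in> SL2Z \<longleftrightarrow> a * d - b * c = 1"
  by (simp add: SL2Z_def)

lemma mat2_in_SL2_mod [simp]: "mat2 a b c d \<in> SL2_mod N \<longleftrightarrow> [a * d - b * c = 1] (mod int N)"
  by (simp add: SL2_mod_def)

lemma one_in_SL2Z: "mat 1 \<in> SL2Z"
  by (simp add: mat2_one)

lemma SL2Z_mult: "G \<in> SL2Z \<Longrightarrow> H \<in> SL2Z \<Longrightarrow> G ** H \<in> SL2Z"
  by (simp add: SL2Z_def det_mul)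

lemma SL2Z_inverse:
  assumes "G \<in> SL2Z"
  obtains H where "H \<in> SL2Z" "H ** G = mat 1" "G ** H = mat 1"
proof (cases rule: mat2_cases[of G])
  case (1 a b c d)
  with assms show ?thesis
    by (intro that[of "mat2 d (- b) (- c) a"]) (auto simp: mat2_one algebra_simps)
qed

lemma SL2Z_subset_SL2_mod: "SL2Z \<subseteq> SL2_mod N"
  by (auto simp: SL2Z_def SL2_mod_def)

lemma SL2_mod_mult: "M \<in> SL2_mod N \<Longrightarrow> M' \<in> SL2_mod N \<Longrightarrow> M ** M' \<in> SL2_mod N"
  using cong_mult[of "det M" 1 "int N" "det M'" 1] by (simp add: SL2_mod_def det_mul)

section \<open>Automorphy factors and the action on the upper half plane\<close>

lemma aut_factor_nonzero:
  assumes "0 < det M" "\<tau> \<in> upper_half_plane"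
  shows "aut_factor M \<tau> \<noteq> 0"
proof
  assume 0: "aut_factor M \<tau> = 0"
  then have "of_int (M $ 2 $ 1) * Im \<tau> = 0"
    by (auto simp: aut_factor_def complex_eq_iff)
  with assms have c: "M $ 2 $ 1 = 0"
    by (auto simp: upper_half_plane_def)
  with 0 have "M $ 2 $ 2 = 0"
    by (simp add: aut_factor_def)
  with c assms(1) show False
    by (simp add: det_2)
qed

lemma aut_factor_mult:
  assumes "aut_factor M \<tau> \<noteq> 0"
  shows "aut_factor (G ** M) \<tau> = aut_factor G (moebius M \<tau>) * aut_factor M \<tau>"
  using assms
  by (cases rule: mat2_cases[of G]; cases rule: mat2_cases[of M])
     (simp add: moebius_def aut_factor_def field_simps)

lemma moebius_mult:
  assumes "aut_factor M \<tau> \<noteq> 0"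
  shows "moebius (G ** M) \<tau> = moebius G (moebius M \<tau>)"
proof -
  define n where "n = of_int (M $ 1 $ 1) * \<tau> + of_int (M $ 1 $ 2)"
  define j where "j = aut_factor M \<tau>"
  have "of_int ((G ** M) $ 1 $ 1) * \<tau> + of_int ((G ** M) $ 1 $ 2) =
      of_int (G $ 1 $ 1) * n + of_int (G $ 1 $ 2) * j"
    by (cases rule: mat2_cases[of G]; cases rule: mat2_cases[of M])
       (simp add: n_def j_def aut_factor_def algebra_simps)
  also have "\<dots> = (of_int (G $ 1 $ 1) * moebius M \<tau> + of_int (G $ 1 $ 2)) * j"
    using assms by (simp add: moebius_def n_def j_def field_simps)
  finally show ?thesis
    using assms by (simp add: moebius_def[of "G ** M"] moebius_def[of G] aut_factor_mult j_def)
qed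

text \<open>Expanding the quotient by the conjugate of its denominator \<open>j\<close> leaves a
  numerator with imaginary part \<open>det M * Im \<tau>\<close> over the positive number
  \<open>|j|^2\<close>.\<close>

lemma moebius_in_upper_half_plane:
  assumes "0 < det M" "\<tau> \<in> upper_half_plane"
  shows "moebius M \<tau> \<in> upper_half_plane"
proof -
  define n where "n = of_int (M $ 1 $ 1) * \<tau> + of_int (M $ 1 $ 2)"
  define j where "j = aut_factor M \<tau>"
  have "j \<noteq> 0"
    using aut_factor_nonzero[OF assms] by (simp add: j_def)
  have "Im (n * cnj j) = of_int (det M) * Im \<tau>"
    by (simp add: n_def j_def aut_factor_def det_2 algebra_simps)
  then have "0 < Im (n * cnj j)"
    using assms by (simp add: upper_half_plane_def)
  moreover have "moebius M \<tau> = n * cnj j / of_real ((cmod j)\<^sup>2)"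
    unfolding moebius_def n_def j_def by (rule complex_div_cnj)
  moreover have "0 < (cmod j)\<^sup>2"
    using \<open>j \<noteq> 0\<close> by simp
  ultimately have "0 < Im (moebius M \<tau>)"
    by (simp only: Im_divide_of_real zero_less_divide_iff) blast
  then show ?thesis
    by (simp add: upper_half_plane_def)
qed


subsection \<open>Left cosets in the double coset of \<open>diag(p, 1)\<close>\<close>

lemma left_coset_absorb:
  assumes "G \<in> SL2Z"
  shows "left_coset (G ** M) = left_coset M"
proof -
  obtain H where H: "H \<in> SL2Z" "H ** G = mat 1" "G ** H = mat 1"
    using SL2Z_inverse[OF assms] .
  have "\<exists>K'. K ** G ** M = K' ** M \<and> K' \<in> SL2Z" if "K \<in> SL2Z" for K
    using that assms SL2Z_mult by blast
  moreover have "\<exists>K'. K ** M = K' ** (G ** M) \<and> K' \<in> SL2Z" if "K \<in> SL2Z" for K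
  proof (intro exI conjI)
    show "K ** M = (K ** H) ** (G ** M)"
      by (metis H(2) matrix_mul_assoc matrix_mul_rid)
  qed (use that H SL2Z_mult in auto)
  ultimately show ?thesis
    unfolding left_coset_def by (auto simp: matrix_mul_assoc)
qed

lemma left_coset_self: "M \<in> left_coset M"
  using one_in_SL2Z by (force simp: left_coset_def)

text \<open>Hermite normal form. The gcd \<open>g\<close> of the first column divides the
  determinant, so it is \<open>1\<close> or \<open>p\<close>. Bezout coefficients clear the lower
  left entry, and a translation then reduces the upper right entry modulo the lower right one. The
  case \<open>g = p\<close> gives the diagonal matrix, \<open>g = 1\<close> the other
  family.\<close>

lemma det_prime_reduction:
  assumes "prime p" "det M = int p"
  obtains G where "G \<in> SL2Z" "G ** M = mat2 (int p) 0 0 1"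
  | G b where "G \<in> SL2Z" "b < p" "G ** M = mat2 1 (int b) 0 (int p)"
proof (cases rule: mat2_cases[of M])
  case (1 a b c d)
  define g where "g = gcd a c"
  have det: "a * d - b * c = int p"
    using assms(2) 1 by simp
  obtain x y where xy: "x * a + y * c = g"
    unfolding g_def using bezout_int by blast
  have "g dvd int p"
    unfolding det[symmetric] g_def by (intro dvd_diff dvd_mult dvd_mult2) auto
  moreover have "prime (int p)"
    using assms(1) by simp
  moreover have "0 \<le> g"
    by (simp add: g_def)
  ultimately have g: "g = 1 \<or> g = int p"
    by (metis abs_of_nonneg dvd_refl normalize_int_def one_dvd prime_int_altdef assms(1) prime_nat_int_transfer)
  have "g \<noteq> 0"
    using g assms(1) by (auto simp: prime_gt_0_nat)
  obtain a' c' where a': "a = g * a'" and c': "c = g * c'"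
    unfolding g_def by (meson dvdE gcd_dvd1 gcd_dvd2)
  have "g * (x * a' + y * c') = g * 1"
    using xy a' c' by (simp add: algebra_simps)
  then have unit: "x * a' + y * c' = 1"
    using \<open>g \<noteq> 0\<close> by (metis mult_cancel_left)
  \<comment> \<open>The second row annihilates the column \<open>(a, c) = g (a', c')\<close>, and
    the determinant is the Bezout sum in \<open>unit\<close>.\<close>
  define G where "G = mat2 x y (- c') a'"
  define b' where "b' = x * b + y * d"
  define d' where "d' = a' * d - c' * b"
  have G: "G \<in> SL2Z"
    using unit by (simp add: G_def mult.commute algebra_simps)
  have GM: "G ** M = mat2 g b' 0 d'"
    using xy a' c' by (simp add: G_def 1 b'_def d'_def algebra_simps)
  have gd: "g * d' = int p"
    using det a' c' by (simp add: d'_def algebra_simps)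
  from g show ?thesis
  proof
    assume "g = 1"
    with gd have d': "d' = int p" by simp
    define H where "H = mat2 1 (- (b' div int p)) 0 1"
    have "H ** G \<in> SL2Z"
      using G by (intro SL2Z_mult) (simp_all add: H_def)
    moreover have "nat (b' mod int p) < p"
      using assms(1) by (simp add: nat_less_iff prime_gt_0_nat)
    moreover have "(H ** G) ** M = mat2 1 (int (nat (b' mod int p))) 0 (int p)"
      using assms(1) \<open>g = 1\<close> d'
      by (simp add: matrix_mul_assoc[symmetric] GM H_def prime_gt_0_nat minus_div_mult_eq_mod)
    ultimately show ?thesis by (rule that(2))
  next
    assume "g = int p"
    with gd \<open>g \<noteq> 0\<close> have d': "d' = 1" by simp
    define H where "H = mat2 1 (- b') 0 1"
    have "H ** G \<in> SL2Z"
      using G by (intro SL2Z_mult) (simp_all add: H_def)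
    moreover have "(H ** G) ** M = mat2 (int p) 0 0 1"
      using \<open>g = int p\<close> d' by (simp add: matrix_mul_assoc[symmetric] GM H_def)
    ultimately show ?thesis by (rule that(1))
  qed
qed

lemma left_cosets_double_coset:
  assumes "prime p"
  shows "left_coset ` double_coset (mat2 (int p) 0 0 1) =
    insert (left_coset (mat2 (int p) 0 0 1)) ((\<lambda>b. left_coset (mat2 1 (int b) 0 (int p))) ` {..<p})"
    (is "?L = ?R")
proof
  show "?L \<subseteq> ?R"
  proof
    fix C assume "C \<in> ?L"
    then obtain G H where GH: "G \<in> SL2Z" "H \<in> SL2Z"
      and C: "C = left_coset (G ** mat2 (int p) 0 0 1 ** H)"
      by (auto simp: double_coset_def)
    define M where "M = G ** mat2 (int p) 0 0 1 ** H"
    have "det M = int p"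
      using GH by (simp add: M_def det_mul SL2Z_def)
    with assms show "C \<in> ?R"
    proof (cases rule: det_prime_reduction)
      case (1 G)
      then show ?thesis
        using left_coset_absorb[of G M] by (simp add: C M_def[symmetric])
    next
      case (2 G b)
      then show ?thesis
        using left_coset_absorb[of G M] by (auto simp: C M_def[symmetric])
    qed
  qed
  have "mat2 (int p) 0 0 1 \<in> double_coset (mat2 (int p) 0 0 1)"
    using one_in_SL2Z by (force simp: double_coset_def)
  \<comment> \<open>With \<open>S = mat2 0 (- 1) 1 0\<close>, the witnesses are \<open>S^-1\<close>
    and \<open>S T^b\<close>: conjugation by \<open>S\<close> swaps the diagonal entries, and
    \<open>diag(1, p) T^b\<close> is the matrix wanted.\<close>
  moreover have "mat2 1 (int b) 0 (int p) \<in> double_coset (mat2 (int p) 0 0 1)" for b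
    unfolding double_coset_def
    by (rule CollectI, rule exI[of _ "mat2 0 1 (- 1) 0"], rule exI[of _ "mat2 0 (- 1) 1 (int b)"]) simp
  ultimately show "?R \<subseteq> ?L"
    by auto
qed

text \<open>A unimodular matrix relating the two has lower left entry \<open>0\<close>, and
  positivity forces both its diagonal entries to be \<open>1\<close>. It is therefore a translation,
  which changes only the upper right entry, by multiples of \<open>d\<close>.\<close>

lemma left_coset_upper_triangular_eq:
  assumes "left_coset (mat2 a b 0 d) = left_coset (mat2 a' b' 0 d')" "0 < a" "0 < a'"
  shows "a = a' \<and> d = d' \<and> [b = b'] (mod d)"
proof -
  have "mat2 a' b' 0 d' \<in> left_coset (mat2 a b 0 d)"
    using assms(1) left_coset_self by blast
  then obtain G where G: "G \<in> SL2Z" "mat2 a' b' 0 d' = G ** mat2 a b 0 d"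
    by (auto simp: left_coset_def)
  obtain x y z w where "G = mat2 x y z w"
    by (rule mat2_cases)
  with G have eqs: "x * w - y * z = 1" "a' = x * a" "b' = x * b + y * d" "0 = z * a" "d' = z * b + w * d"
    by (simp_all add: mat2_eq_iff)
  then have "z = 0" using assms(2) by simp
  with eqs have xw: "x * w = 1" by simp
  moreover have "0 < x"
    using eqs(2) assms(2,3) by (simp add: zero_less_mult_iff)
  ultimately have "x = 1" "w = 1"
    by (auto simp: zmult_eq_1_iff)
  with eqs \<open>z = 0\<close> show ?thesis
    by (auto simp: cong_iff_dvd_diff)
qed

text \<open>The sum ranges over a set of cosets, so the \<open>p + 1\<close> representatives have to
  be pairwise inequivalent: the diagonals \<open>(p, 1)\<close> and \<open>(1, p)\<close> differ,
  and the \<open>b < p\<close> are distinct modulo \<open>p\<close>.\<close>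

lemma sum_left_cosets_double_coset:
  fixes F :: "(int^2^2) set \<Rightarrow> 'b::comm_monoid_add"
  assumes "prime p"
  shows "(\<Sum>C\<in>left_coset ` double_coset (mat2 (int p) 0 0 1). F C) =
    F (left_coset (mat2 (int p) 0 0 1)) + (\<Sum>b<p. F (left_coset (mat2 1 (int b) 0 (int p))))"
proof -
  have p: "1 < p"
    using assms by (rule prime_gt_1_nat)
  have "inj_on (\<lambda>b. left_coset (mat2 1 (int b) 0 (int p))) {..<p}"
  proof (rule inj_onI)
    fix b b' assume b: "b \<in> {..<p}" "b' \<in> {..<p}"
      and "left_coset (mat2 1 (int b) 0 (int p)) = left_coset (mat2 1 (int b') 0 (int p))"
    then have "[int b = int b'] (mod int p)"
      using left_coset_upper_triangular_eq by fastforce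
    with b show "b = b'"
      by (simp add: cong_def)
  qed
  moreover have "left_coset (mat2 (int p) 0 0 1) \<noteq> left_coset (mat2 1 (int b) 0 (int p))" for b
    using p left_coset_upper_triangular_eq[of "int p" 0 1 1 "int b" "int p"] by fastforce
  then have "left_coset (mat2 (int p) 0 0 1) \<notin>
      (\<lambda>b. left_coset (mat2 1 (int b) 0 (int p))) ` {..<p}"
    by blast
  ultimately show ?thesis
    by (simp add: left_cosets_double_coset[OF assms] sum.reindex)
qed


subsection \<open>Matrices over the complex numbers\<close>

lemma matrix_vector_mult_nth: "(A *v v) $ i = (\<Sum>j\<in>UNIV. A $ i $ j * v $ j)"
  by (simp add: matrix_vector_mult_def)

lemma matrix_vector_mult_axis_nth:
  fixes A :: "'b::semiring_1^'n^'m"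
  shows "(A *v axis j 1) $ i = A $ i $ j"
  by (simp add: matrix_vector_mult_nth axis_def if_distrib if_distribR cong: if_cong)

lemma sum_smult_matrix_vector_axis:
  fixes A :: "'b::comm_semiring_1^'n^'m"
  shows "(\<Sum>x\<in>UNIV. h x *s (A *v axis x 1)) = A *v (\<chi> x. h x)"
  by (simp add: vec_eq_iff matrix_vector_mult_axis_nth) (simp add: matrix_vector_mult_nth mult.commute)

lemma mat_scalar_mult_nth:
  fixes A :: "'b::semiring_1^'n^'m"
  shows "(mat c ** A) $ i $ j = c * A $ i $ j"
  by (simp add: matrix_matrix_mult_def mat_def if_distrib if_distribR cong: if_cong)

lemma mat_scalar_commute:
  fixes A :: "'b::comm_semiring_1^'n^'n"
  shows "mat c ** A = A ** mat c"
proof -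
  have "(A ** mat c) $ i $ j = A $ i $ j * c" for i j
    by (simp add: matrix_matrix_mult_def mat_def if_distrib if_distribR cong: if_cong)
  then show ?thesis
    by (simp add: vec_eq_iff mat_scalar_mult_nth mult.commute)
qed

lemma mat_scalar_mult_vector:
  fixes A :: "'b::semiring_1^'n^'m"
  shows "(mat c ** A) *v v = c *s (A *v v)"
  by (simp add: vec_eq_iff matrix_vector_mult_nth mat_scalar_mult_nth sum_distrib_left mult.assoc)

lemma mat_scalar_inverse:
  fixes c :: "'b::field"
  assumes "c \<noteq> 0"
  shows "mat c ** mat (1 / c) = (mat 1 :: 'b^'n^'n)"
  using assms by (simp add: vec_eq_iff mat_scalar_mult_nth) (simp add: mat_def)

text \<open>\<open>matrix_inv\<close> is a Hilbert choice among two-sided inverses; uniqueness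
  identifies it with any inverse that is exhibited.\<close>

lemma matrix_inv_unique:
  fixes A B :: "'b::semiring_1^'n^'n"
  assumes "A ** B = mat 1" "B ** A = mat 1"
  shows "matrix_inv A = B"
  unfolding matrix_inv_def
proof (rule some_equality)
  show "A ** B = mat 1 \<and> B ** A = mat 1"
    using assms by simp
  show "C = B" if "A ** C = mat 1 \<and> C ** A = mat 1" for C
    by (metis assms(2) matrix_mul_assoc matrix_mul_lid matrix_mul_rid that)
qed

lemma matrix_inv_mult:
  fixes A A' B B' :: "'b::semiring_1^'n^'n"
  assumes "A ** A' = mat 1" "A' ** A = mat 1" "B ** B' = mat 1" "B' ** B = mat 1"
  shows "matrix_inv (A ** B) = matrix_inv B ** matrix_inv A"
proof -
  have "matrix_inv (A ** B) = B' ** A'"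
    by (rule matrix_inv_unique) (metis assms matrix_mul_assoc matrix_mul_lid)+
  then show ?thesis
    using assms by (metis matrix_inv_unique)
qed

text \<open>The inverse undoes the permutation \<open>\<sigma>\<close> and divides by the weights.
  One product suffices, since a left inverse of a square matrix over a field is also a right
  inverse. Both kinds of coset representatives act by matrices of this shape.\<close>

lemma matrix_inv_monomial:
  fixes A :: "'b::field^'n^'n"
  assumes A: "\<And>x. A *v axis x 1 = \<alpha> x *s axis (\<sigma> x) 1"
    and "bij \<sigma>" "\<And>x. \<alpha> x \<noteq> 0"
  shows "matrix_inv A *v v = (\<chi> x. v $ \<sigma> x / \<alpha> x)"
proof -
  define B :: "'b^'n^'n" where "B = (\<chi> i j. if j = \<sigma> i then 1 / \<alpha> i else 0)"
  have A': "A $ i $ j = (if i = \<sigma> j then \<alpha> j else 0)" for i j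
    unfolding matrix_vector_mult_axis_nth[symmetric] A by (simp add: axis_def)
  have "(B ** A) $ i $ j = (mat 1 :: 'b^'n^'n) $ i $ j" for i j
  proof -
    have "(B ** A) $ i $ j = (\<Sum>k\<in>UNIV. if k = \<sigma> i then (if \<sigma> i = \<sigma> j then \<alpha> j / \<alpha> i else 0) else 0)"
      unfolding matrix_matrix_mult_def vec_lambda_beta
      by (rule sum.cong) (auto simp: B_def A')
    also have "\<dots> = (if i = j then 1 else 0)"
      using assms(2,3) by (auto simp: inj_eq bij_is_inj)
    finally show ?thesis
      by (simp add: mat_def)
  qed
  then have "B ** A = mat 1"
    by (simp add: vec_eq_iff)
  moreover from this have "A ** B = mat 1"
    by (simp add: matrix_left_right_inverse)
  ultimately have "matrix_inv A = B"
    by (intro matrix_inv_unique)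
  then show ?thesis
    by (simp add: vec_eq_iff matrix_vector_mult_nth B_def if_distrib[of "\<lambda>t. t * c" for c] cong: if_cong)
qed


subsection \<open>The character \<open>e\<close> on rational numbers\<close>

lemma e2pi_add: "e2pi (z + w) = e2pi z * e2pi w"
  by (simp add: e2pi_def distrib_left exp_add)

lemma e2pi_minus: "e2pi (- z) = 1 / e2pi z"
  by (simp add: e2pi_def exp_minus field_simps)

lemma e2pi_nonzero [simp]: "e2pi z \<noteq> 0"
  by (simp add: e2pi_def)

definition e_rat :: "rat \<Rightarrow> complex" where
  "e_rat t = e2pi (of_rat t)"

lemma e_rat_nonzero [simp]: "e_rat t \<noteq> 0"
  by (simp add: e_rat_def)

lemma e_rat_0 [simp]: "e_rat 0 = 1"
  by (simp add: e_rat_def e2pi_def)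

lemma e_rat_add: "e_rat (a + b) = e_rat a * e_rat b"
  by (simp add: e_rat_def of_rat_add e2pi_add)

lemma e_rat_minus: "e_rat (- a) = 1 / e_rat a"
  by (simp add: e_rat_def of_rat_minus e2pi_minus)

lemma e_rat_diff: "e_rat (a - b) = e_rat a / e_rat b"
  using e_rat_add[of a "- b"] by (simp add: e_rat_minus)

lemma e_rat_of_nat_mult: "e_rat (of_nat n * t) = e_rat t ^ n"
  by (induction n) (simp_all add: distrib_right e_rat_add)

lemma complex_of_rat: "(of_rat t :: complex) = of_real (of_rat t)"
  by (cases t) (simp add: of_rat_rat)

lemma e_rat_eq_1_iff: "e_rat t = 1 \<longleftrightarrow> t \<in> \<int>"
proof -
  have "e_rat t = 1 \<longleftrightarrow> (\<exists>n::int. 2 * pi * of_rat t = of_int (2 * n) * pi)"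
    by (simp add: e_rat_def e2pi_def exp_eq_1 complex_of_rat)
  also have "\<dots> \<longleftrightarrow> (\<exists>n::int. of_rat t = (of_rat (of_int n) :: real))"
    by simp
  also have "\<dots> \<longleftrightarrow> t \<in> \<int>"
    unfolding of_rat_eq_iff by (auto elim: Ints_cases)
  finally show ?thesis .
qed

text \<open>Through this, congruences modulo \<open>\<int>\<close> between rational representatives
  become equalities of complex summands.\<close>

lemma e_rat_cong: "a - b \<in> \<int> \<Longrightarrow> e_rat a = e_rat b"
  by (metis e_rat_diff e_rat_eq_1_iff e_rat_nonzero nonzero_divide_eq_eq mult_1)


subsection \<open>Discriminant forms\<close>

lemma zsmul_0 [simp]: "zsmul 0 x = 0"
  by (simp add: zsmul_def)

lemma zsmul_add_1: "zsmul (m + 1) x = zsmul m x + x"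
proof (cases "0 \<le> m")
  case True
  then have "nat (m + 1) = Suc (nat m)" by simp
  with True show ?thesis by (simp add: zsmul_def)
next
  case False
  then have "nat (- m) = Suc (nat (- (m + 1)))" by simp
  with False show ?thesis by (auto simp: zsmul_def)
qed

lemma zsmul_1 [simp]: "zsmul 1 x = x"
  using zsmul_add_1[of 0 x] by simp

lemma zsmul_add: "zsmul (m + n) x = zsmul m x + zsmul n x"
proof (induction n rule: int_induct[where k = 0])
  case base
  show ?case by simp
next
  case (step1 i)
  then show ?case
    using zsmul_add_1[of "m + i" x] zsmul_add_1[of i x] by (simp add: add.assoc)
next
  case (step2 i)
  then show ?case
    using zsmul_add_1[of "m + (i - 1)" x] zsmul_add_1[of "i - 1" x] by (simp add: algebra_simps)
qed

lemma zsmul_uminus: "zsmul (- m) x = - zsmul m x"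
  using zsmul_add[of m "- m" x] by (simp add: eq_neg_iff_add_eq_0 add.commute)

lemma zsmul_mult: "zsmul (m * n) x = zsmul m (zsmul n x)"
proof (induction m rule: int_induct[where k = 0])
  case base
  show ?case by simp
next
  case (step1 i)
  then show ?case
    by (simp add: zsmul_add distrib_right)
next
  case (step2 i)
  then show ?case
    using zsmul_add[of "i * n" "- n" x] zsmul_add[of i "- 1" "zsmul n x"]
    by (simp add: zsmul_uminus left_diff_distrib)
qed

lemma bil_commute: "bil q x y = bil q y x"
  by (simp add: bil_def add.commute)

text \<open>Names the integer error of a congruence, so that several congruences can be combined by
  ordinary algebra.\<close>

lemma Ints_obtain:
  fixes a b :: "'b::ring_1"
  assumes "a - b \<in> \<int>"
  obtains k where "a = b + of_int k"
  using assms by (metis Ints_cases add.commute diff_add_cancel)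

locale disc_form =
  fixes q :: "'a::{ab_group_add,finite} \<Rightarrow> rat"
  assumes discriminant_form: "discriminant_form q"
begin

lemma q_zsmul: "q (zsmul m x) - of_int (m\<^sup>2) * q x \<in> \<int>"
  using discriminant_form by (simp add: discriminant_form_def)

lemma bil_add: "bil q (x + y) z - (bil q x z + bil q y z) \<in> \<int>"
  using discriminant_form by (simp add: discriminant_form_def)

lemma nondegenerate: "(\<And>y. bil q x y \<in> \<int>) \<Longrightarrow> x = 0"
  using discriminant_form by (auto simp: discriminant_form_def)

lemma bil_zero: "bil q 0 y \<in> \<int>"
  using bil_add[of 0 0 y] by simp

text \<open>Additivity holds only modulo \<open>\<int>\<close>, so the induction, upwards and
  downwards from \<open>0\<close>, tracks the error, which changes by an integer at each
  step.\<close>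

lemma bil_zsmul: "bil q (zsmul m x) y - of_int m * bil q x y \<in> \<int>"
proof -
  have step: "(bil q (zsmul (m + 1) x) y - of_int (m + 1) * bil q x y) -
      (bil q (zsmul m x) y - of_int m * bil q x y) \<in> \<int>" for m
    using bil_add[of "zsmul m x" x y] by (simp add: zsmul_add_1) (simp add: algebra_simps)
  show ?thesis
  proof (induction m rule: int_induct[where k = 0])
    case base
    show ?case by (simp add: bil_zero)
  next
    case (step1 i)
    then show ?case
      using Ints_add[OF step[of i]] by simp
  next
    case (step2 i)
    then show ?case
      using Ints_diff[OF step2.IH step[of "i - 1"]] by simp
  qed
qed

text \<open>The product of the denominators of all values of \<open>q\<close> clears every one of
  them. This guarantees that the least element defining \<open>level\<close> has the required
  property.\<close>

lemma level_exists: "\<exists>N>0. \<forall>x. of_nat N * q x \<in> \<int>"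
proof (intro exI conjI allI)
  define d where "d x = nat (snd (quotient_of (q x)))" for x
  have d: "0 < d x" for x
    by (simp add: d_def quotient_of_denom_pos')
  then show "0 < (\<Prod>x\<in>UNIV. d x)"
    by (simp add: prod_pos)
  fix x
  have "of_nat (d x) = (of_int (snd (quotient_of (q x))) :: rat)"
    using quotient_of_denom_pos'[of "q x"] by (simp add: d_def)
  then have "of_nat (d x) * q x = of_int (fst (quotient_of (q x)))"
    using quotient_of_div[of "q x"] quotient_of_denom_pos'[of "q x"] by (metis d divide_eq_eq
        mult.commute of_nat_0_less_iff order_less_irrefl prod.collapse)
  moreover have "(of_nat (\<Prod>x\<in>UNIV. d x) :: rat) = of_nat (\<Prod>x\<in>UNIV-{x}. d x) * of_nat (d x)"
    by (metis UNIV_I finite mult.commute of_nat_mult prod.remove)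
  ultimately show "of_nat (\<Prod>x\<in>UNIV. d x) * q x \<in> \<int>"
    by (metis Ints_mult Ints_of_int Ints_of_nat mult.assoc)
qed

lemma level_q: "of_nat (level q) * q x \<in> \<int>"
  using LeastI_ex[OF level_exists] by (simp add: level_def)

lemma level_bil: "of_nat (level q) * bil q x y \<in> \<int>"
  using level_q by (simp add: bil_def right_diff_distrib)

lemma exponents_level: "n \<in> exponents q y \<Longrightarrow> of_nat (level q) * n \<in> \<int>"
  using Ints_add[OF Ints_mult[OF Ints_of_nat[of "level q"], of "n - q y"] level_q[of y]]
  by (simp add: exponents_def algebra_simps)

lemma level_dvd_mult:
  assumes "of_nat (level q) * t \<in> \<int>" "[m = n] (mod int (level q))"
  shows "of_int m * t - of_int n * t \<in> \<int>"
proof -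
  obtain j where "m = n + int (level q) * j"
    using assms(2) by (metis cong_iff_lin cong_sym)
  then have "of_int m * t - of_int n * t = of_int j * (of_nat (level q) * t)"
    by (simp add: algebra_simps)
  then show ?thesis
    using assms(1) by simp
qed

text \<open>The group is a module over \<open>\<int>/N\<int>\<close>: \<open>(m - n) x\<close> pairs
  integrally with everything because the level clears \<open>bil\<close>, so it is zero by
  nondegeneracy.\<close>

lemma zsmul_cong:
  fixes x :: 'a
  assumes "[m = n] (mod int (level q))"
  shows "zsmul m x = zsmul n x"
proof -
  have "bil q (zsmul (m - n) x) y \<in> \<int>" for y
  proof -
    have "of_int (m - n) * bil q x y \<in> \<int>"
      using level_dvd_mult[OF level_bil assms] by (simp add: left_diff_distrib)
    then show ?thesis
      using Ints_add[OF bil_zsmul[of "m - n" x y]] by simp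
  qed
  then have "zsmul (m - n) x = 0"
    by (rule nondegenerate)
  then show ?thesis
    using zsmul_add[of "m - n" n x] by simp
qed

lemma zsmul_inverse:
  fixes x :: 'a
  assumes "[m * n = 1] (mod int (level q))"
  shows "zsmul m (zsmul n x) = x"
  using zsmul_cong[OF assms] by (simp add: zsmul_mult)

lemma bij_zsmul:
  assumes "[m * n = 1] (mod int (level q))"
  shows "bij (zsmul m :: 'a \<Rightarrow> 'a)"
  by (rule o_bij[of "zsmul n"]) (use assms in \<open>auto simp: fun_eq_iff zsmul_inverse mult.commute\<close>)

text \<open>Modulo \<open>\<int>\<close>, \<open>d q(a x) = d a^2 q(x)\<close>, and
  \<open>d a^2 = a\<close> modulo the level.\<close>

lemma q_zsmul_inverse:
  assumes "[d * a = 1] (mod int (level q))"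
  shows "of_int d * q (zsmul a x) - of_int a * q x \<in> \<int>"
proof -
  obtain k where k: "q (zsmul a x) = of_int (a\<^sup>2) * q x + of_int k"
    by (rule Ints_obtain[OF q_zsmul])
  have "[d * a\<^sup>2 = a] (mod int (level q))"
    using cong_scalar_right[OF assms, of a] by (simp add: power2_eq_square mult.assoc)
  then have "of_int (d * a\<^sup>2) * q x - of_int a * q x \<in> \<int>"
    by (rule level_dvd_mult[OF level_q])
  then have "of_int (d * a\<^sup>2) * q x - of_int a * q x + of_int (d * k) \<in> \<int>"
    by simp
  then show ?thesis
    by (simp add: k algebra_simps)
qed

section \<open>Gauss sums and completing the square\<close>

lemma gauss_sum_e_rat: "gauss_sum q d = (\<Sum>x\<in>UNIV. e_rat (of_int d * q x))"
  by (simp add: gauss_sum_def e_rat_def of_rat_mult)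

text \<open>The substitution of \<open>a x\<close> for \<open>x\<close> turns the exponent
  \<open>d q(x)\<close> into \<open>a q(x)\<close>.\<close>

lemma gauss_sum_inverse:
  assumes "[d * a = 1] (mod int (level q))"
  shows "gauss_sum q d = gauss_sum q a"
proof -
  have "gauss_sum q d = (\<Sum>x\<in>UNIV. e_rat (of_int d * q (zsmul a x)))"
    unfolding gauss_sum_e_rat
    by (rule sum.reindex_bij_betw[symmetric], rule bij_zsmul[of a d])
       (use assms in \<open>simp add: mult.commute\<close>)
  also have "\<dots> = gauss_sum q a"
    unfolding gauss_sum_e_rat by (intro sum.cong e_rat_cong q_zsmul_inverse assms refl)
  finally show ?thesis .
qed

text \<open>Put \<open>w = a (x + z)\<close>. Modulo \<open>\<int>\<close>,
  \<open>d q(w) = a q(x + z)\<close> and \<open>d (w, y) = (x + z, y)\<close> because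
  \<open>d a = 1\<close>, so expanding \<open>d q(y - w)\<close> produces every term on the left
  together with \<open>a (x, z) = (a x, z)\<close>, which is subtracted.\<close>

lemma q_complete_square:
  assumes "[d * a = 1] (mod int (level q))"
  shows "(of_int a * q x + of_int a * q z + of_int d * q y - bil q x y - bil q y z) -
    (of_int d * q (y - zsmul a (x + z)) - bil q (zsmul a x) z) \<in> \<int>"
proof -
  define w where "w = zsmul a (x + z)"
  \<comment> \<open>The integers \<open>k1\<close> to \<open>k6\<close> are the errors of the single
    identities in \<open>\<rat>/\<int>\<close>; the total error is an integral combination of
    them.\<close>
  obtain k1 where k1: "of_int d * q w = of_int a * q (x + z) + of_int k1"
    using Ints_obtain[OF q_zsmul_inverse[OF assms]] unfolding w_def by metis
  obtain k2 where k2: "bil q (- w) y = - of_int a * bil q (x + z) y + of_int k2"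
    using Ints_obtain[OF bil_zsmul[of "- a"]] unfolding w_def by (metis of_int_minus zsmul_uminus)
  obtain k3 where k3: "bil q (x + z) y = bil q x y + bil q z y + of_int k3"
    by (rule Ints_obtain[OF bil_add])
  obtain k4 where k4: "bil q (zsmul a x) z = of_int a * bil q x z + of_int k4"
    by (rule Ints_obtain[OF bil_zsmul])
  obtain k5 where k5: "of_int (d * a) * bil q (x + z) y = of_int 1 * bil q (x + z) y + of_int k5"
    by (rule Ints_obtain[OF level_dvd_mult[OF level_bil assms]])
  obtain k6 where k6: "q (- w) = q w + of_int k6"
    using Ints_obtain[OF q_zsmul[of "- 1" w]] by (auto simp: zsmul_uminus)
  have "q (y - w) = q y + q (- w) + bil q (- w) y"
    by (simp add: bil_def add.commute)
  then have "of_int d * q (y - w) = of_int d * q y + of_int d * q w - of_int (d * a) * bil q (x + z) y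
      + of_int (d * k6 + d * k2)"
    by (simp only: k2 k6) (simp add: algebra_simps)
  also have "\<dots> = of_int d * q y + of_int a * q (x + z) - bil q (x + z) y
      + of_int (d * k6 + d * k2 + k1 - k5)"
    by (simp only: k1 k5)
  also have "\<dots> = of_int d * q y + of_int a * (q x + q z + bil q x z) - bil q x y - bil q z y
      + of_int (d * k6 + d * k2 + k1 - k5 - k3)"
    unfolding k3 by (simp add: bil_def)
  finally have "of_int a * q x + of_int a * q z + of_int d * q y - bil q x y - bil q y z -
    (of_int d * q (y - w) - bil q (zsmul a x) z) = of_int (k4 - (d * k6 + d * k2 + k1 - k5 - k3))"
    using bil_commute[of q y z] by (simp add: k4 algebra_simps)
  then show ?thesis
    unfolding w_def by simp
qed

end


subsection \<open>The Weil representation on upper triangular matrices\<close>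

locale weil_rep = disc_form q
  for q :: "'a::{ab_group_add,finite} \<Rightarrow> rat" +
  fixes s :: int and R :: "int^2^2 \<Rightarrow> 'a cgroup_mat"
  assumes has_signature: "has_signature q s"
    and weil_representation: "weil_representation q s R"
begin

abbreviation "N \<equiv> level q"

lemma R_cong: "M \<in> SL2_mod N \<Longrightarrow> M' \<in> SL2_mod N \<Longrightarrow> mat_cong N M M' \<Longrightarrow> R M = R M'"
  and R_one: "R (mat 1) = mat 1"
  and R_mult: "M \<in> SL2_mod N \<Longrightarrow> M' \<in> SL2_mod N \<Longrightarrow> R (M ** M') = R M ** R M'"
  using weil_representation by (auto simp: weil_representation_def)

lemma R_inverse:
  assumes "M \<in> SL2_mod N" "M' \<in> SL2_mod N" "mat_cong N (M ** M') (mat 1)"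
  shows "R M ** R M' = mat 1"
  using R_mult[of M M'] R_cong[of "M ** M'" "mat 1"] assms
  by (simp add: R_one SL2_mod_mult subsetD[OF SL2Z_subset_SL2_mod one_in_SL2Z])

text \<open>The adjugate is an inverse modulo \<open>N\<close> because the determinant is
  \<open>1\<close> there.\<close>

lemma R_invertible:
  assumes "M \<in> SL2_mod N"
  obtains B where "R M ** B = mat 1" "B ** R M = mat 1"
proof (cases rule: mat2_cases[of M])
  case (1 a b c d)
  have "R M ** R (mat2 d (- b) (- c) a) = mat 1"
    by (rule R_inverse) (use assms in \<open>simp_all add: 1 mat2_one algebra_simps\<close>)
  moreover from this have "R (mat2 d (- b) (- c) a) ** R M = mat 1"
    by (simp add: matrix_left_right_inverse)
  ultimately show ?thesis
    by (rule that)
qed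

lemma gauss_sum_1_nonzero: "gauss_sum q 1 \<noteq> 0"
  using has_signature by (simp add: has_signature_def)

lemma R_T_one: "(R (mat2 1 1 0 1) *v v) $ z = e_rat (q z) * v $ z"
proof -
  have "R (mat2 1 1 0 1) *v axis x 1 = e_rat (q x) *s axis x 1" for x
    using weil_representation by (simp add: weil_representation_def e_rat_def)
  then have "R (mat2 1 1 0 1) $ z $ x = (if x = z then e_rat (q z) else 0)" for x
    unfolding matrix_vector_mult_axis_nth[symmetric] by (simp add: axis_def)
  then show ?thesis
    by (simp add: matrix_vector_mult_nth if_distrib[of "\<lambda>t. t * c" for c] cong: if_cong)
qed

text \<open>By the signature formula for \<open>gauss_sum q 1\<close>, the normalising constant of
  \<open>S\<close> is its reciprocal; later computations then involve Gauss sums instead of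
  \<open>s\<close>.\<close>

lemma R_S: "(R (mat2 0 (- 1) 1 0) *v v) $ z = (\<Sum>y\<in>UNIV. v $ y * e_rat (- bil q y z)) / gauss_sum q 1"
proof -
  have \<kappa>: "e2pi (- of_int s / 8) / of_real (sqrt (real CARD('a))) = 1 / gauss_sum q 1"
    using has_signature e2pi_minus[of "of_int s / 8"] by (simp add: has_signature_def)
  have "R (mat2 0 (- 1) 1 0) *v axis x 1 =
      (1 / gauss_sum q 1) *s (\<Sum>y\<in>UNIV. e_rat (- bil q x y) *s axis y 1)" for x
    using weil_representation unfolding weil_representation_def \<kappa>
    by (simp add: e_rat_def of_rat_minus)
  moreover have "(\<Sum>y\<in>UNIV. e_rat (- bil q x y) *s axis y 1) $ z = e_rat (- bil q x z)" for x
    by (simp add: axis_def if_distrib cong: if_cong)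
  ultimately have "R (mat2 0 (- 1) 1 0) $ z $ x = e_rat (- bil q x z) / gauss_sum q 1" for x
    unfolding matrix_vector_mult_axis_nth[symmetric] by simp
  then show ?thesis
    by (simp add: matrix_vector_mult_nth sum_divide_distrib mult.commute)
qed

lemma R_T: "(R (mat2 1 m 0 1) *v v) $ z = e_rat (of_int m * q z) * v $ z"
proof -
  have step: "R (mat2 1 (m + 1) 0 1) *v v = R (mat2 1 m 0 1) *v (R (mat2 1 1 0 1) *v v)" for m v
    using R_mult[of "mat2 1 m 0 1" "mat2 1 1 0 1"] by (simp add: matrix_vector_mul_assoc add.commute)
  show ?thesis
  proof (induction m arbitrary: v rule: int_induct[where k = 0])
    case base
    show ?case by (simp add: mat2_one[symmetric] R_one)
  next
    case (step1 i)
    then show ?case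
      by (simp add: step R_T_one distrib_right e_rat_add)
  next
    case (step2 i)
    \<comment> \<open>The preimage of \<open>v\<close> under \<open>T\<close>, which reduces the
      power \<open>i - 1\<close> on \<open>v\<close> to the power \<open>i\<close> on
      \<open>w\<close>.\<close>
    define w :: "'a cgroup_alg" where "w = (\<chi> x. v $ x / e_rat (q x))"
    have "R (mat2 1 1 0 1) *v w = v"
      by (simp add: vec_eq_iff R_T_one w_def)
    then have "R (mat2 1 (i - 1) 0 1) *v v = R (mat2 1 i 0 1) *v w"
      using step[of "i - 1" w] by simp
    then show ?case
      by (simp add: step2.IH w_def left_diff_distrib e_rat_diff)
  qed
qed

text \<open>Modulo \<open>N\<close>, \<open>S diag(d, a) = T\<^sup>a S T\<^sup>d S T\<^sup>a\<close>; applying both sides to a basis vector leads to a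
  Gauss sum.\<close>

lemma R_diag:
  assumes "[d * a = 1] (mod int N)"
  shows "R (mat2 d 0 0 a) *v axis x 1 = (gauss_sum q d / gauss_sum q 1) *s axis (zsmul a x) 1"
proof -
  let ?S = "mat2 0 (- 1) 1 0"
  let ?T = "\<lambda>m. mat2 1 m 0 1"
  let ?D = "mat2 d 0 0 a"
  have "R (?S ** ?D) = R (?T a ** (?S ** (?T d ** (?S ** ?T a))))"
  proof (rule R_cong)
    \<comment> \<open>The word on the right multiplies out to
      \<open>mat2 (a*d - 1) (a*(a*d - 1) - a) d (a*d - 1)\<close>, so \<open>a*d - 1\<close> and its
      multiple by \<open>a\<close> must vanish modulo \<open>N\<close>.\<close>
    have "[a * d + - 1 = 1 + - 1] (mod int N)"
      by (rule cong_add) (use assms in \<open>simp_all add: mult.commute\<close>)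
    then have 1: "[a * d - 1 = 0] (mod int N)"
      by simp
    have "[(a * d - 1) * a = 0 * a] (mod int N)"
      by (rule cong_scalar_right[OF 1])
    with 1 show "mat_cong N (?S ** ?D) (?T a ** (?S ** (?T d ** (?S ** ?T a))))"
      using assms by (auto simp: cong_iff_dvd_diff algebra_simps dvd_diff_commute)
  qed (use assms in \<open>auto simp: mult.commute algebra_simps\<close>)
  moreover have "?D \<in> SL2_mod N"
    using assms by simp
  ultimately have "R ?S ** R ?D = R (?T a) ** (R ?S ** (R (?T d) ** (R ?S ** R (?T a))))"
    by (simp add: R_mult SL2_mod_mult del: mat2_mult)
  then have eq: "R ?S *v (R ?D *v axis x 1) =
      R (?T a) *v (R ?S *v (R (?T d) *v (R ?S *v (R (?T a) *v axis x 1))))"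
    by (simp add: matrix_vector_mul_assoc matrix_mul_assoc)
  have "(R ?S *v (R ?D *v axis x 1)) $ z =
      (R ?S *v ((gauss_sum q d / gauss_sum q 1) *s axis (zsmul a x) 1)) $ z" for z
  proof -
    have Ta: "R (?T a) *v axis x 1 = e_rat (of_int a * q x) *s axis x 1"
      by (simp add: vec_eq_iff R_T axis_def)
    have "(R ?S *v (R ?D *v axis x 1)) $ z = e_rat (of_int a * q z) *
        (\<Sum>y\<in>UNIV. e_rat (of_int d * q y) *
           (e_rat (of_int a * q x) * e_rat (- bil q x y) / gauss_sum q 1) * e_rat (- bil q y z)) / gauss_sum q 1"
      unfolding eq R_T R_S Ta
      by (simp add: axis_def if_distrib if_distribR cong: if_cong)
    also have "\<dots> = (\<Sum>y\<in>UNIV. e_rat (of_int a * q x + of_int a * q z + of_int d * q y - bil q x y - bil q y z))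
        / (gauss_sum q 1)\<^sup>2"
      by (simp add: sum_distrib_left sum_divide_distrib e_rat_add e_rat_diff e_rat_minus power2_eq_square field_simps)
    also have "(\<Sum>y\<in>UNIV. e_rat (of_int a * q x + of_int a * q z + of_int d * q y - bil q x y - bil q y z)) =
        (\<Sum>y\<in>UNIV. e_rat (of_int d * q (y - zsmul a (x + z)) - bil q (zsmul a x) z))"
      by (intro sum.cong refl e_rat_cong q_complete_square assms)
    \<comment> \<open>Translation permutes the group, so the shift by \<open>zsmul a (x + z)\<close>
      disappears and a pure Gauss sum remains.\<close>
    also have "\<dots> = (\<Sum>y\<in>UNIV. e_rat (of_int d * q y - bil q (zsmul a x) z))"
      by (rule sum.reindex_bij_witness[of _ "\<lambda>y. y + zsmul a (x + z)" "\<lambda>y. y - zsmul a (x + z)"]) auto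
    also have "\<dots> = gauss_sum q d * e_rat (- bil q (zsmul a x) z)"
      by (simp add: gauss_sum_e_rat e_rat_diff e_rat_minus sum_divide_distrib)
    also have "\<dots> / (gauss_sum q 1)\<^sup>2 =
        (R ?S *v ((gauss_sum q d / gauss_sum q 1) *s axis (zsmul a x) 1)) $ z"
      unfolding R_S by (simp add: axis_def if_distrib if_distribR power2_eq_square cong: if_cong)
    finally show ?thesis .
  qed
  then have "R ?S *v (R ?D *v axis x 1) = R ?S *v ((gauss_sum q d / gauss_sum q 1) *s axis (zsmul a x) 1)"
    by (simp add: vec_eq_iff)
  \<comment> \<open>Cancelling the invertible \<open>R ?S\<close> on the left leaves the action of
    \<open>?D\<close> itself.\<close>
  moreover have "R (mat2 0 1 (- 1) 0) ** R ?S = mat 1"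
    by (rule R_inverse) (simp_all add: mat2_one)
  ultimately show ?thesis
    by (metis matrix_vector_mul_assoc matrix_vector_mul_lid)
qed

text \<open>Otherwise \<open>R_diag\<close> would make \<open>diag(d, a)\<close> kill a basis
  vector, although \<open>diag(a, d)\<close> acts as its inverse.\<close>

lemma gauss_sum_unit_nonzero:
  assumes "[d * a = 1] (mod int N)"
  shows "gauss_sum q d \<noteq> 0"
proof
  assume "gauss_sum q d = 0"
  then have 0: "R (mat2 d 0 0 a) *v axis 0 1 = 0"
    using R_diag[OF assms, of 0] by simp
  have "R (mat2 a 0 0 d) ** R (mat2 d 0 0 a) = mat 1"
    by (rule R_inverse) (use assms in \<open>simp_all add: mat2_one mult.commute\<close>)
  then have "axis 0 1 = R (mat2 a 0 0 d) *v (R (mat2 d 0 0 a) *v axis 0 1)"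
    by (simp add: matrix_vector_mul_assoc)
  also have "\<dots> = 0"
    using 0 by simp
  finally show False
    by simp
qed

end


subsection \<open>The slash action\<close>

locale weil_rep_unit = weil_rep q s R
  for q :: "'a::{ab_group_add,finite} \<Rightarrow> rat" and s R +
  fixes r :: int
  assumes coprime_r: "coprime r (int (level q))"
begin

abbreviation "u \<equiv> modular_inverse (int N) r"

lemma u_r: "[u * r = 1] (mod int N)" and r_u: "[r * u = 1] (mod int N)"
  using coprime_r by (auto intro: cong_modular_inverse1 cong_modular_inverse2)

lemma gauss_sum_ratio_nonzero: "gauss_sum q 1 / gauss_sum q r \<noteq> 0"
  using gauss_sum_1_nonzero gauss_sum_unit_nonzero[OF r_u] by simp

text \<open>For \<open>m = det M\<close>, the first congruence puts \<open>u M\<close> into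
  \<open>SL2_mod N\<close>; for \<open>m = p\<close>, the second evaluates the entry
  \<open>p\<close> of a coset representative after scaling by \<open>u\<close>.\<close>

lemma u_sq_cong:
  assumes "[m = r\<^sup>2] (mod int N)"
  shows "[u\<^sup>2 * m = 1] (mod int N)" "[u * m = r] (mod int N)"
proof -
  have "[u\<^sup>2 * m = u\<^sup>2 * r\<^sup>2] (mod int N)"
    by (rule cong_scalar_left[OF assms])
  also have "u\<^sup>2 * r\<^sup>2 = (u * r)\<^sup>2"
    by (simp add: power_mult_distrib)
  also have "[(u * r)\<^sup>2 = 1\<^sup>2] (mod int N)"
    by (rule cong_pow[OF u_r])
  finally show "[u\<^sup>2 * m = 1] (mod int N)"
    by simp
  have "[u * m = u * r\<^sup>2] (mod int N)"
    by (rule cong_scalar_left[OF assms])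
  also have "u * r\<^sup>2 = u * r * r"
    by (simp add: power2_eq_square)
  also have "[u * r * r = 1 * r] (mod int N)"
    by (rule cong_scalar_right[OF u_r])
  finally show "[u * m = r] (mod int N)"
    by simp
qed

lemma scaled_in_SL2_mod:
  assumes "[det M = r\<^sup>2] (mod int N)"
  shows "(\<chi> i j. u * M $ i $ j) \<in> SL2_mod N"
proof -
  have "det (\<chi> i j. u * M $ i $ j) = u\<^sup>2 * det M"
    by (simp add: det_2 power2_eq_square algebra_simps)
  then show ?thesis
    using u_sq_cong(1)[OF assms] by (simp add: SL2_mod_def)
qed

lemma weil_ext_invertible:
  assumes "[det M = r\<^sup>2] (mod int N)"
  obtains B where "weil_ext q R M r ** B = mat 1" "B ** weil_ext q R M r = mat 1"
proof -
  define c where "c = gauss_sum q 1 / gauss_sum q r"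
  obtain B where B: "R (\<chi> i j. u * M $ i $ j) ** B = mat 1"
    using R_invertible[OF scaled_in_SL2_mod[OF assms]] .
  have "weil_ext q R M r ** (B ** mat (1 / c)) =
      mat c ** (R (\<chi> i j. u * M $ i $ j) ** B) ** mat (1 / c)"
    by (simp add: weil_ext_def c_def matrix_mul_assoc)
  also have "\<dots> = mat 1"
    using gauss_sum_ratio_nonzero by (simp add: B c_def[symmetric] mat_scalar_inverse)
  finally have "weil_ext q R M r ** (B ** mat (1 / c)) = mat 1" .
  moreover from this have "(B ** mat (1 / c)) ** weil_ext q R M r = mat 1"
    by (simp add: matrix_left_right_inverse)
  ultimately show ?thesis
    by (rule that)
qed

text \<open>The scalar Gauss sum factor depends only on \<open>r\<close> and is central, and scaling
  by \<open>u\<close> commutes with left multiplication by \<open>G\<close>.\<close>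

lemma weil_ext_left_mult:
  assumes "G \<in> SL2Z" "[det M = r\<^sup>2] (mod int N)"
  shows "weil_ext q R (G ** M) r = R G ** weil_ext q R M r"
proof -
  have "(\<chi> i j. u * (G ** M) $ i $ j) = G ** (\<chi> i j. u * M $ i $ j)"
    by (simp add: vec_eq_iff matrix_matrix_mult_def sum_distrib_left mult.left_commute)
  then show ?thesis
    using R_mult[of G "\<chi> i j. u * M $ i $ j"] assms scaled_in_SL2_mod SL2Z_subset_SL2_mod[of N]
    by (simp add: weil_ext_def matrix_mul_assoc mat_scalar_commute[of _ "R G"] subset_iff)
qed

lemma vslash_eq:
  "vslash k q R M r f \<tau> = matrix_inv (weil_ext q R M r) *v
     ((of_real (real_of_int (det M) powr (of_int k / 2)) * aut_factor M \<tau> powi (- k)) *s f (moebius M \<tau>))"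
proof -
  have "(\<chi> x. slash k M (\<lambda>\<tau>. f \<tau> $ x) \<tau>) =
      (of_real (real_of_int (det M) powr (of_int k / 2)) * aut_factor M \<tau> powi (- k)) *s f (moebius M \<tau>)"
    by (simp add: vec_eq_iff slash_def)
  then show ?thesis
    by (simp add: vslash_def sum_smult_matrix_vector_axis)
qed

text \<open>Modularity of \<open>f\<close> yields \<open>j^k\<close> and \<open>R G\<close>. The
  first cancels the factor \<open>j^(-k)\<close> from the cocycle rule, the second the inverse of
  \<open>R G\<close> inside \<open>matrix_inv (R G ** ?W)\<close>. Hence the Hecke sum does not
  depend on the chosen representatives.\<close>

lemma vslash_left_mult:
  assumes f: "f \<in> modular_forms k q R" and G: "G \<in> SL2Z"
    and M: "[det M = r\<^sup>2] (mod int N)" "0 < det M" and \<tau>: "\<tau> \<in> upper_half_plane"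
  shows "vslash k q R (G ** M) r f \<tau> = vslash k q R M r f \<tau>"
proof -
  let ?W = "weil_ext q R M r"
  define j where "j = aut_factor G (moebius M \<tau>)"
  define D :: complex where "D = of_real (real_of_int (det M) powr (of_int k / 2))"
  have nz: "aut_factor M \<tau> \<noteq> 0"
    by (rule aut_factor_nonzero[OF M(2) \<tau>])
  have H: "moebius M \<tau> \<in> upper_half_plane"
    by (rule moebius_in_upper_half_plane[OF M(2) \<tau>])
  have "j \<noteq> 0"
    unfolding j_def by (rule aut_factor_nonzero[OF _ H]) (use G in \<open>simp add: SL2Z_def\<close>)
  then have j: "(j * z) powi (- k) * j powi k = z powi (- k)" for z
    by (simp add: power_int_mult_distrib power_int_minus)
  have "det (G ** M) = det M"
    using G by (simp add: det_mul SL2Z_def)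
  then have "vslash k q R (G ** M) r f \<tau> = matrix_inv (R G ** ?W) *v
      ((D * (j * aut_factor M \<tau>) powi (- k)) *s f (moebius G (moebius M \<tau>)))"
    by (simp add: vslash_eq weil_ext_left_mult[OF G M(1)] aut_factor_mult[OF nz] moebius_mult[OF nz] D_def j_def)
  also have "f (moebius G (moebius M \<tau>)) = (j powi k) *s (R G *v f (moebius M \<tau>))"
    using f G H by (simp add: modular_forms_def j_def)
  also have "(D * (j * aut_factor M \<tau>) powi (- k)) *s \<dots> = R G *v ((D * aut_factor M \<tau> powi (- k)) *s f (moebius M \<tau>))"
    by (simp add: vector_scalar_commute vector_smult_assoc mult.assoc j)
  also have "matrix_inv (R G ** ?W) *v \<dots> = matrix_inv ?W *v ((D * aut_factor M \<tau> powi (- k)) *s f (moebius M \<tau>))"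
  proof -
    have "G \<in> SL2_mod N"
      using G SL2Z_subset_SL2_mod by blast
    then obtain B where B: "R G ** B = mat 1" "B ** R G = mat 1"
      by (rule R_invertible)
    obtain C where C: "?W ** C = mat 1" "C ** ?W = mat 1"
      by (rule weil_ext_invertible[OF M(1)])
    have "matrix_inv (R G ** ?W) ** R G = matrix_inv ?W"
      by (simp add: matrix_inv_mult[OF B C] matrix_inv_unique[OF B] matrix_mul_assoc[symmetric] B)
    then show ?thesis
      by (simp add: matrix_vector_mul_assoc)
  qed
  also have "\<dots> = vslash k q R M r f \<tau>"
    by (simp add: vslash_eq D_def)
  finally show ?thesis .
qed

lemma vslash_some_left_coset:
  assumes "f \<in> modular_forms k q R" "[det M = r\<^sup>2] (mod int N)" "0 < det M" "\<tau> \<in> upper_half_plane"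
  shows "vslash k q R (SOME G. G \<in> left_coset M) r f \<tau> = vslash k q R M r f \<tau>"
proof -
  have "(SOME G. G \<in> left_coset M) \<in> left_coset M"
    using left_coset_self by (rule someI)
  then obtain G where "G \<in> SL2Z" "(SOME G. G \<in> left_coset M) = G ** M"
    by (auto simp: left_coset_def)
  then show ?thesis
    using vslash_left_mult assms by simp
qed

text \<open>Scaling by \<open>u\<close> gives \<open>diag(u, r) T^b\<close> modulo \<open>N\<close>.
  The diagonal part contributes \<open>g_u/g\<close>, and \<open>g_u = g_r\<close> since
  \<open>u\<close> and \<open>r\<close> are inverse, so the factor \<open>g/g_r\<close> cancels and
  a monomial matrix remains to be inverted.\<close>

lemma vslash_1_b_0_p:
  assumes p: "[int p = r\<^sup>2] (mod int N)"
  shows "vslash k q R (mat2 1 (int b) 0 (int p)) r f \<tau> $ y =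
    of_real (real p powr (of_int k / 2)) * of_nat p powi (- k) *
      f ((\<tau> + of_nat b) / of_nat p) $ zsmul r y * e_rat (of_nat b * (- q y))"
proof -
  have W: "weil_ext q R (mat2 1 (int b) 0 (int p)) r *v axis x 1 =
      e_rat (of_nat b * q x) *s axis (zsmul r x) 1" for x
  proof -
    have "R (mat2 u (u * int b) 0 (u * int p)) = R (mat2 u 0 0 r ** mat2 1 (int b) 0 1)"
      by (rule R_cong)
         (use u_sq_cong[OF p] u_r in \<open>simp_all add: power2_eq_square mult.assoc\<close>)
    also have "\<dots> = R (mat2 u 0 0 r) ** R (mat2 1 (int b) 0 1)"
      by (rule R_mult) (use u_r in simp_all)
    finally have "weil_ext q R (mat2 1 (int b) 0 (int p)) r *v axis x 1 =
        (gauss_sum q 1 / gauss_sum q r) *s (R (mat2 u 0 0 r) *v (R (mat2 1 (int b) 0 1) *v axis x 1))"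
      by (simp add: weil_ext_def mat_scalar_mult_vector matrix_vector_mul_assoc)
    also have "R (mat2 1 (int b) 0 1) *v axis x 1 = e_rat (of_nat b * q x) *s axis x 1"
      by (simp add: vec_eq_iff R_T axis_def)
    finally show ?thesis
      using gauss_sum_ratio_nonzero
      by (simp add: vector_scalar_commute R_diag[OF u_r] gauss_sum_inverse[OF u_r] vector_smult_assoc)
  qed
  have "bij (zsmul r :: 'a \<Rightarrow> 'a)"
    by (rule bij_zsmul[OF r_u])
  from matrix_inv_monomial[OF W this] show ?thesis
    by (simp add: vslash_eq aut_factor_def moebius_def e_rat_minus)
qed

text \<open>Scaling by \<open>u\<close> gives \<open>diag(r, u)\<close> modulo \<open>N\<close>,
  whose factor \<open>g_r/g\<close> cancels \<open>g/g_r\<close>; what remains is a permutation of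
  the basis.\<close>

lemma vslash_p_0_0_1:
  assumes p: "[int p = r\<^sup>2] (mod int N)"
  shows "vslash k q R (mat2 (int p) 0 0 1) r f \<tau> $ y =
    of_real (real p powr (of_int k / 2)) * f (of_nat p * \<tau>) $ zsmul u y"
proof -
  have W: "weil_ext q R (mat2 (int p) 0 0 1) r *v axis x 1 = 1 *s axis (zsmul u x) 1" for x
  proof -
    have "R (mat2 (u * int p) 0 0 u) = R (mat2 r 0 0 u)"
      by (rule R_cong)
         (use u_sq_cong[OF p] r_u in \<open>simp_all add: power2_eq_square mult_ac\<close>)
    then show ?thesis
      using gauss_sum_ratio_nonzero
      by (simp add: weil_ext_def mat_scalar_mult_vector R_diag[OF r_u] vector_smult_assoc)
  qed
  have "bij (zsmul u :: 'a \<Rightarrow> 'a)"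
    by (rule bij_zsmul[OF u_r])
  from matrix_inv_monomial[OF W this] show ?thesis
    by (simp add: vslash_eq aut_factor_def moebius_def)
qed

lemma hecke_prime_nth:
  assumes "prime p" and p: "[int p = r\<^sup>2] (mod int N)"
    and f: "f \<in> modular_forms k q R" and \<tau>: "\<tau> \<in> upper_half_plane"
  shows "hecke k q R (mat2 (int p) 0 0 1) r f \<tau> $ y =
    of_nat p powi (k - 1) * f (of_nat p * \<tau>) $ zsmul u y +
    (1 / of_nat p) * (\<Sum>b<p. e_rat (of_nat b * (- q y)) * f ((\<tau> + of_nat b) / of_nat p) $ zsmul r y)"
proof -
  have "0 < p"
    using assms(1) by (rule prime_gt_0_nat)
  \<comment> \<open>The half-integral exponents from the Hecke normalisation and from the slash
    action add up to the integer \<open>k - 1\<close>.\<close>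
  have "real p powr (of_int k / 2 - 1) * real p powr (of_int k / 2) = real p powr of_int (k - 1)"
    by (simp add: powr_add[symmetric])
  also have "\<dots> = real p powi (k - 1)"
    using \<open>0 < p\<close> by (intro powr_real_of_int') auto
  finally have "complex_of_real (real p powr (of_int k / 2 - 1) * real p powr (of_int k / 2)) =
      of_real (real p powi (k - 1))"
    by (rule arg_cong)
  then have c1: "complex_of_real (real p powr (of_int k / 2 - 1)) * of_real (real p powr (of_int k / 2)) =
      of_nat p powi (k - 1)"
    by (simp only: of_real_mult of_real_power_int of_real_of_nat_eq)
  \<comment> \<open>The representatives with lower right entry \<open>p\<close> carry a further
    \<open>p^(-k)\<close> from the automorphy factor, which leaves \<open>1/p\<close>, the weight of
    an average.\<close>
  have c2: "(of_nat p :: complex) powi (k - 1) * of_nat p powi (- k) = 1 / of_nat p"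
    using \<open>0 < p\<close> by (simp add: power_int_minus power_int_diff field_simps)
  have "hecke k q R (mat2 (int p) 0 0 1) r f \<tau> =
      of_real (real p powr (of_int k / 2 - 1)) *s
       (vslash k q R (mat2 (int p) 0 0 1) r f \<tau> + (\<Sum>b<p. vslash k q R (mat2 1 (int b) 0 (int p)) r f \<tau>))"
    using \<open>0 < p\<close> p unfolding hecke_def sum_left_cosets_double_coset[OF assms(1)]
    by (simp add: vslash_some_left_coset[OF f _ _ \<tau>])
  then have "hecke k q R (mat2 (int p) 0 0 1) r f \<tau> $ y =
      of_real (real p powr (of_int k / 2 - 1)) * of_real (real p powr (of_int k / 2)) *
      (f (of_nat p * \<tau>) $ zsmul u y + of_nat p powi (- k) *
         (\<Sum>b<p. e_rat (of_nat b * (- q y)) * f ((\<tau> + of_nat b) / of_nat p) $ zsmul r y))"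
    by (simp only: vector_smult_component vector_add_component sum_component
          vslash_1_b_0_p[OF p] vslash_p_0_0_1[OF p] sum_distrib_left distrib_left mult_ac)
  then show ?thesis
    unfolding c1 distrib_left mult.assoc[symmetric] c2 .
qed

end


subsection \<open>Fourier expansions\<close>

text \<open>In lowest terms \<open>n = a/d\<close> the denominator divides \<open>M\<close>, hence
  is prime to \<open>p\<close>, so the order at \<open>p\<close> is that of \<open>a\<close>. Since
  \<open>p\<close> does not divide \<open>M\<close>, \<open>M n / p\<close> is integral exactly when
  \<open>p\<close> divides \<open>a\<close>.\<close>

lemma rat_ord_eq_0_iff:
  assumes p: "prime p" "coprime p M" and n: "of_nat M * n \<in> \<int>"
  shows "rat_ord p n = 0 \<longleftrightarrow> of_nat M * (n / of_nat p) \<notin> \<int>"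
proof -
  obtain a d where ad: "quotient_of n = (a, d)"
    by fastforce
  have n_eq: "n = of_int a / of_int d" and "0 < d" and "coprime a d"
    using ad by (auto simp: quotient_of_div quotient_of_denom_pos quotient_of_coprime)
  have ip: "prime (int p)" "coprime (int p) (int M)"
    using p by auto
  obtain j where "of_nat M * n = of_int j"
    using n by (auto elim: Ints_cases)
  then have "(of_int (int M * a) :: rat) = of_int (j * d)"
    using \<open>0 < d\<close> by (simp add: n_eq field_simps)
  then have "int M * a = j * d"
    by (simp only: of_int_eq_iff)
  then have "d dvd int M"
    using \<open>coprime a d\<close> by (metis coprime_commute coprime_dvd_mult_left_iff dvd_triv_right)
  then obtain e where e: "int M = d * e" ..
  have "\<not> int p dvd d"
    using \<open>d dvd int M\<close> ip by (meson coprime_common_divisor dvd_refl dvd_trans not_prime_unit)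
  \<comment> \<open>At \<open>n = 0\<close> the order is \<open>\<infinity>\<close> while
    \<open>multiplicity\<close> returns \<open>0\<close>, so this value has to be excluded
    explicitly.\<close>
  then have "rat_ord p n = 0 \<longleftrightarrow> n \<noteq> 0 \<and> multiplicity (int p) a = 0"
    by (simp add: rat_ord_def ad not_dvd_imp_multiplicity_0)
  also have "\<dots> \<longleftrightarrow> \<not> int p dvd a"
  proof (cases "a = 0")
    case False
    then show ?thesis
      using ip(1) \<open>0 < d\<close> prime_multiplicity_gt_zero_iff[of "int p" a] by (auto simp: n_eq)
  qed (simp add: n_eq)
  also have "int p dvd a \<longleftrightarrow> of_nat M * (n / of_nat p) \<in> \<int>"
  proof
    assume "int p dvd a"
    then obtain a' where "a = int p * a'" ..
    moreover have "(of_nat M :: rat) = of_int d * of_int e"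
      using e by (metis of_int_mult of_int_of_nat_eq)
    ultimately have "of_nat M * (n / of_nat p) = of_int (e * a')"
      using \<open>0 < d\<close> prime_gt_0_nat[OF p(1)] by (simp add: n_eq)
    then show "of_nat M * (n / of_nat p) \<in> \<int>"
      by simp
  next
    assume "of_nat M * (n / of_nat p) \<in> \<int>"
    then obtain i where "of_nat M * (n / of_nat p) = of_int i"
      by (auto elim: Ints_cases)
    then have "(of_int (int M * a) :: rat) = of_int (int p * (i * d))"
      using \<open>0 < d\<close> prime_gt_0_nat[OF p(1)] by (simp add: n_eq field_simps)
    then have "int M * a = int p * (i * d)"
      by (simp only: of_int_eq_iff)
    then show "int p dvd a"
      using ip(2) by (metis coprime_dvd_mult_right_iff dvd_triv_left)
  qed
  finally show ?thesis .
qed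

lemma has_sum_sum:
  fixes f :: "'i \<Rightarrow> 'c \<Rightarrow> 'b::topological_comm_monoid_add"
  assumes "finite I" "\<And>i. i \<in> I \<Longrightarrow> (f i has_sum a i) A"
  shows "((\<lambda>x. \<Sum>i\<in>I. f i x) has_sum (\<Sum>i\<in>I. a i)) A"
  using assms by (induction I rule: finite_induct) (auto intro: has_sum_add)

text \<open>Orthogonality of characters: \<open>e_rat t\<close> is a \<open>p\<close>-th root of
  unity, so the geometric sum vanishes unless the root is \<open>1\<close>.\<close>

lemma sum_e_rat_powers:
  assumes "of_nat p * t \<in> \<int>"
  shows "(\<Sum>b<p. e_rat (of_nat b * t)) = (if t \<in> \<int> then of_nat p else 0)"
proof (cases "t \<in> \<int>")
  case True
  then show ?thesis
    by (simp add: e_rat_of_nat_mult e_rat_eq_1_iff[THEN iffD2])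
next
  case False
  moreover have "e_rat t ^ p = 1"
    using assms by (simp add: e_rat_of_nat_mult[symmetric] e_rat_eq_1_iff)
  ultimately show ?thesis
    by (simp add: e_rat_of_nat_mult geometric_sum e_rat_eq_1_iff)
qed

context weil_rep_unit
begin

text \<open>Modulo \<open>\<int>\<close>, \<open>p q(y) = r^2 q(y) = q(r y)\<close>.\<close>

lemma exponents_mult:
  assumes "[int p = r\<^sup>2] (mod int N)" "n \<in> exponents q y"
  shows "of_nat p * n \<in> exponents q (zsmul r y)"
proof -
  have "n - q y \<in> \<int>"
    using assms(2) by (simp add: exponents_def)
  from Ints_diff[OF Ints_add[OF Ints_mult[OF Ints_of_nat[of p] this]
      level_dvd_mult[OF level_q[of y] assms(1)]] q_zsmul[of r y]]
  show ?thesis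
    by (simp add: exponents_def algebra_simps)
qed

text \<open>Integrality of \<open>N n / p\<close> allows \<open>u^2 p\<close> to be replaced by
  \<open>1\<close> in front of \<open>n / p\<close>; then
  \<open>n / p = u^2 n = u^2 q(y) = q(u y)\<close> modulo \<open>\<int>\<close>.\<close>

lemma exponents_divide:
  assumes "0 < p" "[int p = r\<^sup>2] (mod int N)" "n \<in> exponents q y" "of_nat N * (n / of_nat p) \<in> \<int>"
  shows "n / of_nat p \<in> exponents q (zsmul u y)"
proof -
  have eq: "of_int (u\<^sup>2 * int p) * (n / of_nat p) = of_int (u\<^sup>2) * n"
    using assms(1) by simp
  have "of_int (u\<^sup>2 * int p) * (n / of_nat p) - of_int 1 * (n / of_nat p) \<in> \<int>"
    using level_dvd_mult[OF assms(4) u_sq_cong(1)[OF assms(2)]] .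
  then have "of_int (u\<^sup>2) * n - n / of_nat p \<in> \<int>"
    unfolding eq by simp
  moreover have "of_int (u\<^sup>2) * (n - q y) \<in> \<int>"
    using assms(3) by (intro Ints_mult) (simp_all add: exponents_def)
  ultimately have "of_int (u\<^sup>2) * (n - q y) - (of_int (u\<^sup>2) * n - n / of_nat p)
      - (q (zsmul u y) - of_int (u\<^sup>2) * q y) \<in> \<int>"
    using q_zsmul by (meson Ints_diff)
  also have "of_int (u\<^sup>2) * (n - q y) - (of_int (u\<^sup>2) * n - n / of_nat p)
      - (q (zsmul u y) - of_int (u\<^sup>2) * q y) = n / of_nat p - q (zsmul u y)"
    by (simp only: right_diff_distrib)
  finally show ?thesis
    by (simp add: exponents_def)
qed

text \<open>Expand each translate over the exponents \<open>m\<close> of \<open>r y\<close>. The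
  phases average to \<open>1\<close> if \<open>m / p\<close> is an exponent of \<open>y\<close> and
  to \<open>0\<close> otherwise; reindexing by \<open>m = p n\<close> gives the claim.\<close>

lemma has_sum_average_translates:
  assumes p: "0 < p" "[int p = r\<^sup>2] (mod int N)"
    and c: "has_fourier_expansion q f c" and \<tau>: "\<tau> \<in> upper_half_plane"
  shows "((\<lambda>n. c (zsmul r y) (of_nat p * n) * e2pi (of_rat n * \<tau>)) has_sum
    (1 / of_nat p) * (\<Sum>b<p. e_rat (of_nat b * (- q y)) * f ((\<tau> + of_nat b) / of_nat p) $ zsmul r y))
    (exponents q y)"
proof -
  let ?x = "zsmul r y"
  let ?g = "\<lambda>m. (1 / of_nat p) * (\<Sum>b<p. e_rat (of_nat b * (- q y)) *
      (c ?x m * e2pi (of_rat m * ((\<tau> + of_nat b) / of_nat p))))"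
  have "(\<tau> + of_nat b) / of_nat p \<in> upper_half_plane" for b
    using p(1) \<tau> by (simp add: upper_half_plane_def Im_divide_of_nat)
  then have "(?g has_sum
      (1 / of_nat p) * (\<Sum>b<p. e_rat (of_nat b * (- q y)) * f ((\<tau> + of_nat b) / of_nat p) $ ?x))
      (exponents q ?x)"
    using c unfolding has_fourier_expansion_def
    by (intro has_sum_cmult_right has_sum_sum finite_lessThan) blast
  moreover have g: "?g m = (if m / of_nat p \<in> exponents q y then c ?x m * e2pi (of_rat (m / of_nat p) * \<tau>) else 0)"
    if "m \<in> exponents q ?x" for m
  proof -
    define t where "t = m / of_nat p - q y"
    \<comment> \<open>Modulo \<open>\<int>\<close>,
      \<open>m = q(r y) = r^2 q(y) = p q(y)\<close>.\<close>
    have pt: "of_nat p * t \<in> \<int>"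
    proof -
      have "m - q ?x \<in> \<int>"
        using that by (simp add: exponents_def)
      from Ints_diff[OF Ints_add[OF this q_zsmul[of r y]] level_dvd_mult[OF level_q[of y] p(2)]]
      show ?thesis
        using p(1) by (simp add: t_def algebra_simps)
    qed
    have "e_rat (of_nat b * (- q y)) * (c ?x m * e2pi (of_rat m * ((\<tau> + of_nat b) / of_nat p))) =
        c ?x m * e2pi (of_rat (m / of_nat p) * \<tau>) * e_rat (of_nat b * t)" for b
    proof -
      have "of_rat m * ((\<tau> + of_nat b) / of_nat p) =
          of_rat (m / of_nat p) * \<tau> + of_rat (of_nat b * (m / of_nat p))"
        by (simp add: of_rat_divide of_rat_mult add_divide_distrib algebra_simps)
      moreover have "e_rat (of_nat b * t) = e_rat (of_nat b * (- q y)) * e_rat (of_nat b * (m / of_nat p))"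
        unfolding e_rat_add[symmetric] by (simp add: t_def algebra_simps)
      ultimately show ?thesis
        by (simp add: e2pi_add e_rat_def)
    qed
    then have "?g m = c ?x m * e2pi (of_rat (m / of_nat p) * \<tau>) * ((\<Sum>b<p. e_rat (of_nat b * t)) / of_nat p)"
      by (simp only: sum_distrib_left[symmetric]) simp
    also have "(\<Sum>b<p. e_rat (of_nat b * t)) / of_nat p = (if m / of_nat p \<in> exponents q y then 1 else 0)"
      using p(1) sum_e_rat_powers[OF pt] by (simp add: t_def exponents_def)
    finally show ?thesis
      by simp
  qed
  ultimately have "((\<lambda>m. c ?x m * e2pi (of_rat (m / of_nat p) * \<tau>)) has_sum
      (1 / of_nat p) * (\<Sum>b<p. e_rat (of_nat b * (- q y)) * f ((\<tau> + of_nat b) / of_nat p) $ ?x))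
      ((\<lambda>n. of_nat p * n) ` exponents q y)"
  \<comment> \<open>The index set shrinks to the multiples \<open>p n\<close>: they are exponents of
    \<open>r y\<close> by \<open>exponents_mult\<close>, and the averaged term vanishes at all other
    exponents.\<close>
  proof (subst has_sum_cong_neutral[where g = ?g and T = "exponents q ?x"])
    fix m assume m: "m \<in> exponents q ?x - (\<lambda>n. of_nat p * n) ` exponents q y"
    then have "m / of_nat p \<notin> exponents q y"
      using p(1) by (metis DiffD2 image_eqI nonzero_mult_div_cancel_left of_nat_0_less_iff
          order_less_irrefl times_divide_eq_right)
    with g m show "?g m = 0" by simp
  next
    fix m assume "m \<in> (\<lambda>n. of_nat p * n) ` exponents q y - exponents q ?x"
    then show "c ?x m * e2pi (of_rat (m / of_nat p) * \<tau>) = 0"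
      using exponents_mult[OF p(2)] by blast
  next
    fix m assume "m \<in> (\<lambda>n. of_nat p * n) ` exponents q y \<inter> exponents q ?x"
    then show "c ?x m * e2pi (of_rat (m / of_nat p) * \<tau>) = ?g m"
      using g[of m] p(1) by auto
  qed
  moreover have "inj_on (\<lambda>n. of_nat p * n :: rat) (exponents q y)"
    using p(1) by (simp add: inj_on_def)
  ultimately show ?thesis
    using p(1) by (simp add: has_sum_reindex o_def)
qed

text \<open>The expansion of the component at \<open>u y\<close>, taken at \<open>p \<tau>\<close>,
  has exponents \<open>p m\<close>. The exponents of \<open>y\<close> not of this form are exactly
  those of order \<open>0\<close> at \<open>p\<close>, where the coefficient is set to
  \<open>0\<close>.\<close>

lemma has_sum_dilation:
  assumes p: "prime p" "[int p = r\<^sup>2] (mod int N)"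
    and c: "has_fourier_expansion q f c" and \<tau>: "\<tau> \<in> upper_half_plane"
  shows "((\<lambda>n. (if rat_ord p n = 0 then 0 else c (zsmul u y) (n / of_nat p)) * e2pi (of_rat n * \<tau>)) has_sum
    f (of_nat p * \<tau>) $ zsmul u y) (exponents q y)"
proof -
  let ?x = "zsmul u y"
  have "0 < p"
    using p(1) by (rule prime_gt_0_nat)
  have "coprime (r\<^sup>2) (int N)"
    using coprime_r by simp
  then have "coprime (int p) (int N)"
    using cong_imp_coprime[OF cong_sym[OF p(2)]] by simp
  then have coprime: "coprime p N"
    by simp
  have dil: "of_nat p * m \<in> exponents q y" if "m \<in> exponents q ?x" for m
    using exponents_mult[OF p(2) that] by (simp add: zsmul_inverse[OF r_u])
  \<comment> \<open>If \<open>N n / p\<close> is integral, \<open>exponents_divide\<close> applies;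
    conversely, \<open>N\<close> clears the denominator of every exponent.\<close>
  have ord: "rat_ord p n = 0 \<longleftrightarrow> n / of_nat p \<notin> exponents q ?x" if "n \<in> exponents q y" for n
    using rat_ord_eq_0_iff[OF p(1) coprime exponents_level[OF that]]
      exponents_divide[OF \<open>0 < p\<close> p(2) that] exponents_level[of "n / of_nat p" ?x] by blast
  have "of_nat p * \<tau> \<in> upper_half_plane"
    using \<open>0 < p\<close> \<tau> by (simp add: upper_half_plane_def)
  then have "((\<lambda>m. c ?x m * e2pi (of_rat m * (of_nat p * \<tau>))) has_sum f (of_nat p * \<tau>) $ ?x) (exponents q ?x)"
    using c by (simp add: has_fourier_expansion_def)
  moreover have "inj_on (\<lambda>n. of_nat p * n :: rat) (exponents q ?x)"
    using \<open>0 < p\<close> by (simp add: inj_on_def)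
  ultimately have "((\<lambda>n. c ?x (n / of_nat p) * e2pi (of_rat n * \<tau>)) has_sum f (of_nat p * \<tau>) $ ?x)
      ((\<lambda>n. of_nat p * n) ` exponents q ?x)"
    using \<open>0 < p\<close> by (simp add: has_sum_reindex o_def of_rat_mult mult_ac)
  then show ?thesis
  proof (subst has_sum_cong_neutral[where g = "\<lambda>n. c ?x (n / of_nat p) * e2pi (of_rat n * \<tau>)"
        and T = "(\<lambda>n. of_nat p * n) ` exponents q ?x"])
    fix n assume "n \<in> (\<lambda>n. of_nat p * n) ` exponents q ?x - exponents q y"
    then show "c ?x (n / of_nat p) * e2pi (of_rat n * \<tau>) = 0"
      using dil by blast
  next
    fix n assume n: "n \<in> exponents q y - (\<lambda>n. of_nat p * n) ` exponents q ?x"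
    then have "n / of_nat p \<notin> exponents q ?x"
      using \<open>0 < p\<close> by (metis DiffD2 image_eqI nonzero_mult_div_cancel_left of_nat_0_less_iff
          order_less_irrefl times_divide_eq_right)
    with n ord show "(if rat_ord p n = 0 then 0 else c ?x (n / of_nat p)) * e2pi (of_rat n * \<tau>) = 0"
      by simp
  next
    fix n assume "n \<in> exponents q y \<inter> (\<lambda>n. of_nat p * n) ` exponents q ?x"
    then show "(if rat_ord p n = 0 then 0 else c ?x (n / of_nat p)) * e2pi (of_rat n * \<tau>) =
        c ?x (n / of_nat p) * e2pi (of_rat n * \<tau>)"
      using ord \<open>0 < p\<close> by auto
  qed
qed

end

theorem theorem4p2:
  fixes q :: "'a::{ab_group_add,finite} \<Rightarrow> rat"
    and s k r :: int
    and p :: nat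
    and R :: "int^2^2 \<Rightarrow> 'a cgroup_mat"
    and f :: "complex \<Rightarrow> 'a cgroup_alg"
    and c :: "'a \<Rightarrow> rat \<Rightarrow> complex"
  assumes "discriminant_form q"
    and "has_signature q s" and "even s"
    and "weil_representation q s R"
    and "prime p"
    and "coprime r (int (level q))"
    and "[int p = r\<^sup>2] (mod int (level q))"
    and "f \<in> modular_forms k q R"
    and "has_fourier_expansion q f c"
  shows "has_fourier_expansion q (hecke k q R (mat2 (int p) 0 0 1) r f)
    (\<lambda>x n. c (zsmul r x) (of_nat p * n) +
       of_nat p powi (k - 1) *
         (if rat_ord p n = 0 then 0
          else c (zsmul (modular_inverse (int (level q)) r) x) (n / of_nat p)))"
proof -
  interpret weil_rep_unit q s R r
    using assms by unfold_locales
  show ?thesis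
    unfolding has_fourier_expansion_def
  proof (intro ballI allI)
    fix \<tau> y assume \<tau>: "\<tau> \<in> upper_half_plane"
    have "0 < p"
      using assms(5) by (rule prime_gt_0_nat)
    \<comment> \<open>Both expansions run over the exponents of \<open>y\<close>, so they add
      termwise: the average gives the first coefficient, the dilation scaled by
      \<open>p^(k - 1)\<close> the second.\<close>
    from has_sum_add[OF has_sum_average_translates[OF this assms(7,9) \<tau>, of y]
        has_sum_cmult_right[OF has_sum_dilation[OF assms(5,7,9) \<tau>, of y], of "of_nat p powi (k - 1)"]]
    show "((\<lambda>n. (c (zsmul r y) (of_nat p * n) + of_nat p powi (k - 1) *
         (if rat_ord p n = 0 then 0 else c (zsmul u y) (n / of_nat p))) * e2pi (of_rat n * \<tau>)) has_sum
        hecke k q R (mat2 (int p) 0 0 1) r f \<tau> $ y) (exponents q y)"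
      unfolding hecke_prime_nth[OF assms(5,7,8) \<tau>]
      by (simp only: distrib_right mult.assoc add.commute)
  qed
qed

end
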